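(* Let $m\ge0$ and let $S=\mathrm{Spec}(R)$ for a local ring $(R,\mathfrak m)$ over $\mathbb F_p$ whose residue field is algebraically closed. Let $\odot\in\{\oslash,\otimes\}$ and let $(\mathcal F,\nabla^{(m)})$ be a $p^{m+1}$-flat $\mathcal D^{(m)}_\odot$-module such that $\mathcal F$ is a (locally) free $\mathcal O_\odot$-module of rank $n>0$. Then there exists an isomorphism of $\mathcal D_\odot^{(m)}$-modules $$\bigoplus_{i=1}^n\mathscr O^{(m)}_{\odot,d_i}\ \xrightarrow{\ \sim\ }\ (\mathcal F,\nabla^{(m)})$$ for some $d_1,\dots,d_n\in\mathbb Z/p^{m+1}\mathbb Z$. (This implies that, for each $a=0,\dots,m$, the $a$-th monodromy operator of $\nabla^{(m)}$ can be transformed, after choosing a suitable trivialization of the restriction of $\mathcal F$ to the origin, into the diagonal matrix with diagonal entries $(-d_1)_{[a]},\dots,(-d_n)_{[a]}$.) Moreover, the resulting multiset $[d_1,\dots,d_n]$ depends only on the isomorphism class of $(\mathcal F,\nabla^{(m)})$.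
   Context: $p$ is a prime. $\mathcal O_\oslash=R[[t]]$, $\mathcal O_\otimes=R[[t_1,t_2]]/(t_1t_2)$, $U_\odot=\mathrm{Spec}(\mathcal O_\odot)$; $U_\oslash$ has the log structure given by $t=0$ over $S$ with trivial log structure, and $U_\otimes^{\log}/S^{\log}$ is the standard log structure of a node ($\mathbb N^{2}\to\mathcal O_\otimes$, $(n_1,n_2)\mapsto t_1^{n_1}t_2^{n_2}$, over $\mathbb N\to R$, $k\mapsto0^k$, via the diagonal). Put $q_j=\lfloor j/p^m\rfloor$. $\mathcal D_\oslash^{(m)}$ is the ring of logarithmic differential operators of level $m$ on $U_\oslash^{\log}/S$ (trivial $m$-PD structure): the free left $\mathcal O_\oslash$-module on $\partial^{\langle j\rangle}$ ($j\ge0$), acting on $\mathcal O_\oslash$ by $\partial^{\langle j\rangle}(t^k)=q_j!\binom kjt^k$, with Leibniz rule $\partial^{\langle j\rangle}h=\sum_{i+i'=j}\frac{q_j!}{q_i!q_{i'}!}\partial^{\langle i\rangle}(h)\partial^{\langle i'\rangle}$ and $$\partial^{\langle j'\rangle}\partial^{\langle j''\rangle}=\sum_{j=\max\{j',j''\}}^{j'+j''}\frac{j!}{(j'+j''-j)!\,(j-j')!\,(j-j'')!}\cdot\frac{q_{j'}!\,q_{j''}!}{q_j!}\,\partial^{\langle j\rangle}.$$ $\mathcal D_\otimes^{(m)}$ is the analogous ring for $U_\otimes^{\log}/S^{\log}$; it is free over $\mathcal O_\otimes$ on $\{\partial_1^{\langle j\rangle}\}_j$ and also on $\{\partial_2^{\langle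 j\rangle}\}_j$, the bases associated with the logarithmic coordinates $t_1$, $t_2$, each satisfying the same multiplication rule, and related for $0<j\le p^m$ by $\partial_2^{\langle j\rangle}=(-1)^j\sum_{j'=1}^j\binom{j-1}{j'-1}\partial_1^{\langle j'\rangle}$. Restricting to the branch $t_2=0$ (resp. $t_1=0$), with $t_1=t$ (resp. $t_2=t$), identifies the restriction of $\mathcal D_\otimes^{(m)}$ with $\mathcal D_\oslash^{(m)}$ via $\partial_1^{\langle j\rangle}\leftrightarrow\partial^{\langle j\rangle}$ (resp. $\partial_2^{\langle j\rangle}\leftrightarrow\partial^{\langle j\rangle}$). A $\mathcal D_\odot^{(m)}$-module is $p^{m+1}$-flat (dormant) if its $p^{m+1}$-curvature vanishes, i.e. $\partial^{\langle p^{m+1}\rangle}$ (resp. $\partial_1^{\langle p^{m+1}\rangle}$) acts as $0$. For $d\in\mathbb Z/p^{m+1}\mathbb Z$ let $\tilde d\in\{0,\dots,p^{m+1}-1\}$ be its representative, with $p$-adic expansion $\tilde d=\sum_{a=0}^mp^a\tilde d_{[a]}$, and let $d_{[a]}\in\mathbb F_p$ be the class of $\tilde d_{[a]}$. $\mathscr O_{\oslash,d}^{(m)}$ is $\mathcal O_\oslash$ with $\partial^{\langle j\rangle}(t^k)=q_j!\binom{k-\tilde d}jt^k$. $\mathscr O_{\otimes,d}^{(m)}$ is $\mathcal O_\otimes$ with the unique $\mathcal D_\otimes^{(m)}$-module structure whose restriction to the branch $t_2=0$ is $\mathscr O^{(m)}_{\oslash,d}$ and whose restriction to the branch $t_1=0$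 is $\mathscr O^{(m)}_{\oslash,-d}$. The $a$-th monodromy operator is the endomorphism of the restriction of $\mathcal F$ to the origin ($t=0$, resp. $t_1=t_2=0$) induced by $\partial^{\langle p^a\rangle}$ (resp. $\partial_1^{\langle p^a\rangle}$). *)

theory Defs
  imports
    "HOL-Computational_Algebra.Formal_Power_Series"
    "HOL-Number_Theory.Modular_Inverse"
    "HOL-Algebra.Algebraic_Closure_Type"
    "HOL-Library.Function_Algebras"
    "HOL-Library.Set_Algebras"
    "HOL-Library.Multiset"
begin

section \<open>Coefficients in the localization of the integers at p\<close>

text \<open>
  The structure constants of the ring of differential operators of level m are rational
  numbers whose denominators are prime to p, but need not be integers: for p = 2, m = 1,
  j' = j'' = 3 and j = 6 the constant in the product rule is 10/3. They are mapped to a ring of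
  characteristic p through the field with p elements.
\<close>

definition zp_reduce :: "nat \<Rightarrow> rat \<Rightarrow> 'o::comm_ring_1" where
  "zp_reduce p c = (case quotient_of c of (a, b) \<Rightarrow> of_int (a * modular_inverse (int p) b))"

definition qfact :: "nat \<Rightarrow> nat \<Rightarrow> nat \<Rightarrow> rat" where
  "qfact p m j = fact (j div p ^ m)"

definition leibniz_coeff :: "nat \<Rightarrow> nat \<Rightarrow> nat \<Rightarrow> nat \<Rightarrow> rat" where
  "leibniz_coeff p m i i' = qfact p m (i + i') / (qfact p m i * qfact p m i')"

definition product_coeff :: "nat \<Rightarrow> nat \<Rightarrow> nat \<Rightarrow> nat \<Rightarrow> nat \<Rightarrow> rat" where
  "product_coeff p m j' j'' j =
     fact j / (fact (j' + j'' - j) * fact (j - j') * fact (j - j''))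
       * (qfact p m j' * qfact p m j'' / qfact p m j)"

definition power_op_coeff :: "nat \<Rightarrow> nat \<Rightarrow> nat \<Rightarrow> int \<Rightarrow> 'o::comm_ring_1" where
  "power_op_coeff p m j e = zp_reduce p (qfact p m j * (of_int e gchoose j))"


section \<open>Modules over the ring of logarithmic differential operators of level m\<close>

text \<open>
  The ring of differential operators is the free left module over the structure ring O on the
  elements D j, with products determined by the Leibniz rule and by the product rule. A left
  module over it is therefore an O-module with additive operators D j that satisfy these two
  rules and for which D 0, the unit of the ring, is the identity. The parameter DO is the
  action on O itself.
\<close>

locale diff_op_module = Modules.module scale
  for p m :: nat
    and DO :: "nat \<Rightarrow> 'o::comm_ring_1 \<Rightarrow> 'o"
    and scale :: "'o \<Rightarrow> 'f::ab_group_add \<Rightarrow> 'f"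
    and D :: "nat \<Rightarrow> 'f \<Rightarrow> 'f" +
  assumes D_0: "D 0 v = v"
    and D_add: "D j (v + w) = D j v + D j w"
    and D_leibniz: "D j (scale h v) =
      (\<Sum>i\<le>j. scale (zp_reduce p (leibniz_coeff p m i (j - i)) * DO i h) (D (j - i) v))"
    and D_D: "D j' (D j'' v) =
      (\<Sum>j = max j' j''..j' + j''. scale (zp_reduce p (product_coeff p m j' j'' j)) (D j v))"

definition flat :: "nat \<Rightarrow> nat \<Rightarrow> (nat \<Rightarrow> 'f \<Rightarrow> 'f::zero) \<Rightarrow> bool" where
  "flat p m D \<longleftrightarrow> (\<forall>v. D (p ^ (m + 1)) v = 0)"

definition free_of_rank :: "nat \<Rightarrow> ('o::comm_ring_1 \<Rightarrow> 'f::ab_group_add \<Rightarrow> 'f) \<Rightarrow> bool" where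
  "free_of_rank n scale \<longleftrightarrow> (\<exists>B. finite B \<and> card B = n \<and>
     \<not> Modules.module.dependent scale B \<and> Modules.module.span scale B = UNIV)"

definition linear_iso ::
  "'v::plus set \<Rightarrow> ('r \<Rightarrow> 'v \<Rightarrow> 'v) \<Rightarrow> 'w::plus set \<Rightarrow> ('r \<Rightarrow> 'w \<Rightarrow> 'w) \<Rightarrow> ('v \<Rightarrow> 'w) \<Rightarrow> bool" where
  "linear_iso A sA B sB \<phi> \<longleftrightarrow> bij_betw \<phi> A B \<and>
     (\<forall>u\<in>A. \<forall>v\<in>A. \<phi> (u + v) = \<phi> u + \<phi> v) \<and> (\<forall>r. \<forall>v\<in>A. \<phi> (sA r v) = sB r (\<phi> v))"

definition diff_op_iso ::
  "'v::plus set \<Rightarrow> ('o \<Rightarrow> 'v \<Rightarrow> 'v) \<Rightarrow> (nat \<Rightarrow> 'v \<Rightarrow> 'v) \<Rightarrow>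
   'w::plus set \<Rightarrow> ('o \<Rightarrow> 'w \<Rightarrow> 'w) \<Rightarrow> (nat \<Rightarrow> 'w \<Rightarrow> 'w) \<Rightarrow> ('v \<Rightarrow> 'w) \<Rightarrow> bool" where
  "diff_op_iso A sA DA B sB DB \<phi> \<longleftrightarrow>
     linear_iso A sA B sB \<phi> \<and> (\<forall>j. \<forall>v\<in>A. \<phi> (DA j v) = DB j (\<phi> v))"

text \<open>
  The direct sum of n modules with underlying O-module O: sequences in O that vanish from
  index n on. Addition is pointwise.
\<close>

definition dsum_carrier :: "nat \<Rightarrow> (nat \<Rightarrow> 'o::zero) set" where
  "dsum_carrier n = {v. \<forall>i\<ge>n. v i = 0}"

definition dsum_scale :: "'o::times \<Rightarrow> (nat \<Rightarrow> 'o) \<Rightarrow> nat \<Rightarrow> 'o" where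
  "dsum_scale h v = (\<lambda>i. h * v i)"

definition dsum_op ::
  "(int \<Rightarrow> nat \<Rightarrow> 'o \<Rightarrow> 'o) \<Rightarrow> int list \<Rightarrow> nat \<Rightarrow> (nat \<Rightarrow> 'o) \<Rightarrow> nat \<Rightarrow> 'o::zero" where
  "dsum_op E ds j v = (\<lambda>i. if i < length ds then E (ds ! i) j (v i) else 0)"

definition iso_from_dsum ::
  "(int \<Rightarrow> nat \<Rightarrow> 'o \<Rightarrow> 'o) \<Rightarrow> int list \<Rightarrow>
   ('o::comm_ring_1 \<Rightarrow> 'f::ab_group_add \<Rightarrow> 'f) \<Rightarrow> (nat \<Rightarrow> 'f \<Rightarrow> 'f) \<Rightarrow> bool" where
  "iso_from_dsum E ds scale D \<longleftrightarrow>
     (\<exists>\<phi>. diff_op_iso (dsum_carrier (length ds)) dsum_scale (dsum_op E ds) UNIV scale D \<phi>)"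

definition isomorphic ::
  "('o::comm_ring_1 \<Rightarrow> 'f::ab_group_add \<Rightarrow> 'f) \<Rightarrow> (nat \<Rightarrow> 'f \<Rightarrow> 'f) \<Rightarrow>
   ('o \<Rightarrow> 'g::ab_group_add \<Rightarrow> 'g) \<Rightarrow> (nat \<Rightarrow> 'g \<Rightarrow> 'g) \<Rightarrow> bool" where
  "isomorphic scale D scale' D' \<longleftrightarrow> (\<exists>\<phi>. diff_op_iso UNIV scale D UNIV scale' D' \<phi>)"


section \<open>Restriction to the origin and monodromy operators\<close>

text \<open>
  G is a set of generators of the ideal of the origin and c is the structure map from R to O.
  The restriction of F to the origin is F modulo the submodule generated by G F; its elements
  are cosets, added as sets.
\<close>

definition origin_submodule ::
  "('o::comm_ring_1 \<Rightarrow> 'f::ab_group_add \<Rightarrow> 'f) \<Rightarrow> 'o set \<Rightarrow> 'f set" where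
  "origin_submodule scale G = Modules.module.span scale {scale g v |g v. g \<in> G}"

definition fibre :: "('o::comm_ring_1 \<Rightarrow> 'f::ab_group_add \<Rightarrow> 'f) \<Rightarrow> 'o set \<Rightarrow> 'f set set" where
  "fibre scale G = range (\<lambda>v. v +o origin_submodule scale G)"

text \<open>
  The map on cosets induced by a map f that preserves the submodule sends the coset C of v to
  the coset of f v, that is, to the sum of the set f ` C and the submodule.
\<close>

definition fibre_map ::
  "('o::comm_ring_1 \<Rightarrow> 'f::ab_group_add \<Rightarrow> 'f) \<Rightarrow> 'o set \<Rightarrow> ('f \<Rightarrow> 'f) \<Rightarrow> 'f set \<Rightarrow> 'f set" where
  "fibre_map scale G f C = f ` C + origin_submodule scale G"

definition fibre_scale ::
  "('a \<Rightarrow> 'o) \<Rightarrow> ('o::comm_ring_1 \<Rightarrow> 'f::ab_group_add \<Rightarrow> 'f) \<Rightarrow> 'o set \<Rightarrow>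
   'a \<Rightarrow> 'f set \<Rightarrow> 'f set" where
  "fibre_scale c scale G r = fibre_map scale G (scale (c r))"

definition monodromy ::
  "nat \<Rightarrow> ('o::comm_ring_1 \<Rightarrow> 'f::ab_group_add \<Rightarrow> 'f) \<Rightarrow> (nat \<Rightarrow> 'f \<Rightarrow> 'f) \<Rightarrow> 'o set \<Rightarrow>
   nat \<Rightarrow> 'f set \<Rightarrow> 'f set" where
  "monodromy p scale D G a = fibre_map scale G (D (p ^ a))"

definition trivialization ::
  "nat \<Rightarrow> ('a::comm_ring_1 \<Rightarrow> 'o) \<Rightarrow> ('o::comm_ring_1 \<Rightarrow> 'f::ab_group_add \<Rightarrow> 'f) \<Rightarrow> 'o set \<Rightarrow>
   ((nat \<Rightarrow> 'a) \<Rightarrow> 'f set) \<Rightarrow> bool" where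
  "trivialization n c scale G =
     linear_iso (dsum_carrier n) dsum_scale (fibre scale G) (fibre_scale c scale G)"

text \<open>
  Elements of Z/NZ, for N the (m+1)-st power of p, are given by their representatives in
  {0..<N}.
\<close>

definition residues_mod :: "nat \<Rightarrow> nat \<Rightarrow> int set" where
  "residues_mod p m = {0..<int p ^ (m + 1)}"

definition neg_mod :: "nat \<Rightarrow> nat \<Rightarrow> int \<Rightarrow> int" where
  "neg_mod p m d = (- d) mod (int p ^ (m + 1))"

definition digit :: "nat \<Rightarrow> nat \<Rightarrow> int \<Rightarrow> int" where
  "digit p a x = x div int p ^ a mod int p"

text \<open>
  In one trivialization of the restriction to the origin all monodromy operators become
  diagonal, the a-th one with entries the a-th p-adic digits of the -d.
\<close>

definition diagonal_monodromy ::
  "nat \<Rightarrow> nat \<Rightarrow> ('a::comm_ring_1 \<Rightarrow> 'o) \<Rightarrow> 'o set \<Rightarrow> int list \<Rightarrow>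
   ('o::comm_ring_1 \<Rightarrow> 'f::ab_group_add \<Rightarrow> 'f) \<Rightarrow> (nat \<Rightarrow> 'f \<Rightarrow> 'f) \<Rightarrow> bool" where
  "diagonal_monodromy p m c G ds scale D \<longleftrightarrow>
     (\<exists>\<tau>. trivialization (length ds) c scale G \<tau> \<and>
       (\<forall>a\<le>m. \<forall>v\<in>dsum_carrier (length ds).
          monodromy p scale D G a (\<tau> v) =
          \<tau> (\<lambda>i. if i < length ds then of_int (digit p a (neg_mod p m (ds ! i))) * v i else 0)))"


section \<open>The smooth case\<close>

text \<open>The operators of the rank one module with exponent d; for d = 0 the action on R[[t]].\<close>

definition smooth_op :: "nat \<Rightarrow> nat \<Rightarrow> int \<Rightarrow> nat \<Rightarrow> 'a::comm_ring_1 fps \<Rightarrow> 'a fps" where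
  "smooth_op p m d j f = Abs_fps (\<lambda>k. power_op_coeff p m j (int k - d) * fps_nth f k)"


section \<open>The nodal case\<close>

text \<open>
  In the type \<open>'a fps fps\<close> of power series in two variables, the variable of the inner series
  is t1 and that of the outer series is t2, so \<open>fps_nth (fps_nth f b) a\<close> is the coefficient of
  the monomial with exponents a of t1 and b of t2.
\<close>

definition t1t2 :: "'a::comm_ring_1 fps fps" where
  "t1t2 = fps_const fps_X * fps_X"

definition node_rel :: "'a::comm_ring_1 fps fps \<Rightarrow> 'a fps fps \<Rightarrow> bool" where
  "node_rel f g \<longleftrightarrow> t1t2 dvd f - g"

lemma t1t2_dvd_iff:
  "t1t2 dvd f \<longleftrightarrow> (\<forall>k. fps_nth (fps_nth f k) 0 = 0) \<and> (\<forall>k. fps_nth (fps_nth f 0) k = 0)"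
proof
  assume "t1t2 dvd f"
  then obtain g where "f = t1t2 * g" by (rule dvdE)
  then have "f = fps_const fps_X * (fps_X * g)" by (simp add: t1t2_def mult.assoc)
  then show "(\<forall>k. fps_nth (fps_nth f k) 0 = 0) \<and> (\<forall>k. fps_nth (fps_nth f 0) k = 0)" by simp
next
  assume *: "(\<forall>k. fps_nth (fps_nth f k) 0 = 0) \<and> (\<forall>k. fps_nth (fps_nth f 0) k = 0)"
  define g where "g = Abs_fps (\<lambda>b. Abs_fps (\<lambda>a. fps_nth (fps_nth f (Suc b)) (Suc a)))"
  have "f = fps_const fps_X * (fps_X * g)"
  proof (intro fps_ext)
    fix b a
    show "fps_nth (fps_nth f b) a = fps_nth (fps_nth (fps_const fps_X * (fps_X * g)) b) a"
      using * by (cases a; cases b) (auto simp: g_def)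
  qed
  then show "t1t2 dvd f" by (metis dvd_triv_left mult.assoc t1t2_def)
qed

lemma equivp_node_rel: "equivp (node_rel :: 'a::comm_ring_1 fps fps \<Rightarrow> _)"
proof (rule equivpI)
  show "reflp (node_rel :: 'a fps fps \<Rightarrow> _)" by (auto intro!: reflpI simp: node_rel_def)
  show "symp (node_rel :: 'a fps fps \<Rightarrow> _)"
    by (intro sympI) (metis node_rel_def dvd_minus_iff minus_diff_eq)
  show "transp (node_rel :: 'a fps fps \<Rightarrow> _)"
  proof (rule transpI)
    fix f g h :: "'a fps fps"
    assume "node_rel f g" "node_rel g h"
    then have "t1t2 dvd (f - g) + (g - h)" unfolding node_rel_def by (rule dvd_add)
    then show "node_rel f h" by (simp add: node_rel_def)
  qed
qed

quotient_type (overloaded) 'a node = "'a::comm_ring_1 fps fps" / node_rel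
  by (rule equivp_node_rel)

instantiation node :: (comm_ring_1) comm_ring_1
begin

lift_definition zero_node :: "'a node" is 0 .
lift_definition one_node :: "'a node" is 1 .
lift_definition plus_node :: "'a node \<Rightarrow> 'a node \<Rightarrow> 'a node" is "(+)"
  unfolding node_rel_def by (metis add_diff_add dvd_add)
lift_definition uminus_node :: "'a node \<Rightarrow> 'a node" is uminus
  unfolding node_rel_def by (metis dvd_minus_iff minus_diff_minus)
lift_definition minus_node :: "'a node \<Rightarrow> 'a node \<Rightarrow> 'a node" is "(-)"
proof -
  fix f f' g g' :: "'a fps fps"
  assume "node_rel f f'" "node_rel g g'"
  then have "t1t2 dvd (f - f') - (g - g')" unfolding node_rel_def by (rule dvd_diff)
  then show "node_rel (f - g) (f' - g')" by (simp add: node_rel_def algebra_simps)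
qed
lift_definition times_node :: "'a node \<Rightarrow> 'a node \<Rightarrow> 'a node" is "(*)"
proof -
  fix f f' g g' :: "'a fps fps"
  assume "node_rel f f'" "node_rel g g'"
  then have "t1t2 dvd (f - f') * g + f' * (g - g')"
    unfolding node_rel_def by (intro dvd_add dvd_mult dvd_mult2)
  then show "node_rel (f * g) (f' * g')" by (simp add: node_rel_def algebra_simps)
qed

instance
proof
  show "(0::'a node) \<noteq> 1"
    by transfer (auto simp: node_rel_def t1t2_dvd_iff intro!: exI[of _ 0])
qed (transfer, simp add: node_rel_def algebra_simps)+

end

lift_definition node_const :: "'a::comm_ring_1 \<Rightarrow> 'a node" is "\<lambda>r. fps_const (fps_const r)" .
lift_definition node_t1 :: "'a::comm_ring_1 node" is "fps_const fps_X" .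
lift_definition node_t2 :: "'a::comm_ring_1 node" is "fps_X" .

text \<open>
  The operators attached to the coordinate t1 on the rank one module with exponent d; for
  d = 0 the action on the ring of the node. A logarithmic derivation that sends t1 to t1 sends
  t2 to -t2, whence the weight a - b - d of the monomial with exponents a and b. This is the
  structure with restriction of exponent d to the branch t2 = 0 (\<open>node_op_branch1\<close>) and of
  exponent -d to the branch t1 = 0 (\<open>node_op_branch2\<close>); for the latter it suffices to treat
  the operators of order at most the m-th power of p, which generate.
\<close>

lift_definition node_op :: "nat \<Rightarrow> nat \<Rightarrow> int \<Rightarrow> nat \<Rightarrow> 'a::comm_ring_1 node \<Rightarrow> 'a node" is
  "\<lambda>p m d j f. Abs_fps (\<lambda>b. Abs_fps (\<lambda>a.
     power_op_coeff p m j (int a - int b - d) * fps_nth (fps_nth f b) a))"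
  by (auto simp: node_rel_def t1t2_dvd_iff simp flip: right_diff_distrib)

lift_definition branch1 :: "'a::comm_ring_1 node \<Rightarrow> 'a fps" is "\<lambda>f. fps_nth f 0"
  by (auto simp: node_rel_def t1t2_dvd_iff intro!: fps_ext)

lift_definition branch2 :: "'a::comm_ring_1 node \<Rightarrow> 'a fps" is
  "\<lambda>f. Abs_fps (\<lambda>k. fps_nth (fps_nth f k) 0)"
  by (auto simp: node_rel_def t1t2_dvd_iff intro!: fps_ext)

text \<open>The operators attached to t2, for 0 < j and j at most the m-th power of p.\<close>

definition second_coord_op ::
  "(nat \<Rightarrow> 'f \<Rightarrow> 'f::comm_ring_1) \<Rightarrow> nat \<Rightarrow> 'f \<Rightarrow> 'f" where
  "second_coord_op D j v =
     (\<Sum>j' = 1..j. of_int ((-1) ^ j * int ((j - 1) choose (j' - 1))) * D j' v)"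

lemma node_op_branch1: "branch1 (node_op p m d j f) = smooth_op p m d j (branch1 f)"
  by transfer (simp add: smooth_op_def)

lemma gchoose_of_int:
  obtains z where "(of_int e gchoose j :: rat) = of_int z"
proof (cases e)
  case (nonneg n)
  then have "(of_int e gchoose j :: rat) = of_int (int (n choose j))"
    by (simp add: binomial_gbinomial)
  then show ?thesis by (rule that)
next
  case (neg n)
  have "(of_int e gchoose j :: rat) = (-1) ^ j * ((of_nat (n + j) :: rat) gchoose j)"
    using gbinomial_minus[of "1 + of_nat n :: rat" j] by (simp add: neg add_ac)
  also have "\<dots> = of_int ((-1) ^ j * int ((n + j) choose j))"
    by (simp del: of_nat_add flip: binomial_gbinomial)
  finally show ?thesis by (rule that)
qed

lemma zp_reduce_of_int:
  assumes "Factorial_Ring.prime p" "CHAR('o::comm_ring_1) = p"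
  shows "zp_reduce p (of_int z) = (of_int z :: 'o)"
proof -
  have "[1 * modular_inverse (int p) 1 = 1] (mod int p)"
    by (rule cong_modular_inverse1) simp
  then have "[z * modular_inverse (int p) 1 = z] (mod int p)"
    by (metis cong_scalar_left mult.right_neutral mult_1)
  then have "(of_int (z * modular_inverse (int p) 1) :: 'o) = of_int z"
    using assms(2) by (simp add: of_int_eq_iff_cong_CHAR del: of_int_mult)
  then show ?thesis by (simp add: zp_reduce_def)
qed

lemma of_int_zero_if_dvd:
  assumes "CHAR('o::comm_ring_1) = p" "int p dvd z"
  shows "(of_int z :: 'o) = 0"
  using assms of_int_eq_0_iff_char_dvd by blast

lemma dvd_prime_power_choose:
  fixes p :: nat
  assumes "Factorial_Ring.prime p" "0 < i" "i < p ^ n"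
  shows "p dvd (p ^ n choose i)"
proof (rule ccontr)
  assume "\<not> p dvd (p ^ n choose i)"
  then have "coprime (p ^ n) (p ^ n choose i)"
    using assms(1) by (simp add: prime_imp_coprime)
  moreover have "i * (p ^ n choose i) = p ^ n * (p ^ n - 1 choose (i - 1))"
    using assms(2,3) times_binomial_minus1_eq by blast
  then have "p ^ n dvd i * (p ^ n choose i)" by simp
  ultimately have "p ^ n dvd i" using coprime_dvd_mult_left_iff by blast
  with assms(2,3) show False using dvd_imp_le by fastforce
qed

text \<open>For j at most the m-th power of p the scalar is the generalized binomial coefficient.\<close>

lemma power_op_coeff_eq:
  assumes "Factorial_Ring.prime p" "CHAR('o::comm_ring_1) = p" "j \<le> p ^ m"
    and "(of_int e gchoose j :: rat) = of_int z"
  shows "(power_op_coeff p m j e :: 'o) = of_int z"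
proof -
  have "j div p ^ m \<le> 1"
    using div_le_mono[OF assms(3), of "p ^ m"] prime_gt_0_nat[OF assms(1)] by simp
  then have "(fact (j div p ^ m) :: rat) = 1"
    by (metis fact_0 fact_1 le_SucE One_nat_def le_zero_eq)
  then show ?thesis
    using assms by (simp add: power_op_coeff_def qfact_def zp_reduce_of_int)
qed

lemma power_op_coeff_add_period:
  assumes "Factorial_Ring.prime p" "CHAR('o::comm_ring_1) = p" "j \<le> p ^ m"
  shows "(power_op_coeff p m j (e + int p ^ (m + 1)) :: 'o) = power_op_coeff p m j e"
proof -
  define N where "N = p ^ (m + 1)"
  have "p > 1" using assms(1) by (rule prime_gt_1_nat)
  then have "j < N" using assms(3) by (simp add: N_def le_less_trans)
  have "\<exists>z. \<forall>i. (of_int e gchoose i :: rat) = of_int (z i)"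
    by (rule choice) (metis gchoose_of_int)
  then obtain z where z: "\<And>i. (of_int e gchoose i :: rat) = of_int (z i)" by blast
  have "(of_int (e + int N) gchoose j :: rat) = (of_nat N + of_int e) gchoose j"
    by (simp add: add.commute)
  also have "\<dots> = (\<Sum>i=0..j. (of_nat N gchoose i) * (of_int e gchoose (j - i)))"
    by (rule gbinomial_Vandermonde[symmetric])
  also have "\<dots> = of_int (\<Sum>i=0..j. int (N choose i) * z (j - i))"
    by (simp add: z flip: binomial_gbinomial)
  finally have "(power_op_coeff p m j (e + int N) :: 'o) =
      of_int (\<Sum>i=0..j. int (N choose i) * z (j - i))"
    using assms by (rule_tac power_op_coeff_eq)
  also have "\<dots> = (\<Sum>i=0..j. of_int (int (N choose i) * z (j - i)))"
    by (rule of_int_sum)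
  also have "\<dots> = (\<Sum>i\<in>{0}. of_int (int (N choose i) * z (j - i)))"
  proof (rule sum.mono_neutral_right)
    show "\<forall>i\<in>{0..j} - {0}. (of_int (int (N choose i) * z (j - i)) :: 'o) = 0"
    proof
      fix i assume "i \<in> {0..j} - {0}"
      then have "p dvd (N choose i)"
        unfolding N_def using \<open>j < N\<close> assms(1)
        by (intro dvd_prime_power_choose) (auto simp: N_def)
      then have "int p dvd int (N choose i) * z (j - i)" by simp
      then show "(of_int (int (N choose i) * z (j - i)) :: 'o) = 0"
        using assms(2) by (rule_tac of_int_zero_if_dvd)
    qed
  qed auto
  also have "\<dots> = power_op_coeff p m j e"
    using power_op_coeff_eq[OF assms z] by simp
  finally show ?thesis by (simp add: N_def)
qed

lemma power_op_coeff_minus: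
  assumes "Factorial_Ring.prime p" "CHAR('o::comm_ring_1) = p" "0 < j" "j \<le> p ^ m"
  shows "(\<Sum>j' = 1..j. of_int ((-1) ^ j * int ((j - 1) choose (j' - 1))) *
           power_op_coeff p m j' (- e)) = (power_op_coeff p m j e :: 'o)"
proof -
  have "\<exists>z. \<forall>i. (of_int (- e) gchoose i :: rat) = of_int (z i)"
    by (rule choice) (metis gchoose_of_int)
  then obtain z where z: "\<And>i. (of_int (- e) gchoose i :: rat) = of_int (z i)" by blast
  have "(of_int e gchoose j :: rat) = (-1) ^ j * ((of_nat (j - 1) + of_int (- e)) gchoose j)"
    using gbinomial_negated_upper[of "of_int e :: rat" j] assms(3)
    by (simp add: of_nat_diff algebra_simps)
  also have "(of_nat (j - 1) + of_int (- e) :: rat) gchoose j =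
      (\<Sum>i=0..j. (of_nat (j - 1) gchoose i) * (of_int (- e) gchoose (j - i)))"
    by (rule gbinomial_Vandermonde[symmetric])
  also have "\<dots> = (\<Sum>i=0..j. of_int (int ((j - 1) choose i) * z (j - i)))"
    by (simp only: z flip: binomial_gbinomial) simp
  also have "\<dots> = (\<Sum>i=0..j-1. of_int (int ((j - 1) choose i) * z (j - i)))"
    using assms(3) by (intro sum.mono_neutral_right) (auto simp: binomial_eq_0)
  also have "\<dots> = (\<Sum>j'=1..j. of_int (int ((j - 1) choose (j' - 1)) * z j'))"
  proof (intro sum.reindex_bij_witness[of _ "\<lambda>i. j - i" "\<lambda>i. j - i"])
    fix i assume "i \<in> {0..j - 1}"
    then have "i \<le> j - 1" and "j - i - 1 = j - 1 - i" by auto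
    then have "(j - 1) choose (j - i - 1) = (j - 1) choose i"
      using binomial_symmetric[of i "j - 1"] by simp
    then show "of_int (int ((j - 1) choose (j - i - 1)) * z (j - i)) =
        (of_int (int ((j - 1) choose i) * z (j - i)) :: rat)" by simp
  qed (use assms(3) in auto)
  finally have "(of_int e gchoose j :: rat) =
      of_int ((-1) ^ j * (\<Sum>j'=1..j. int ((j - 1) choose (j' - 1)) * z j'))"
    by simp
  then have "(power_op_coeff p m j e :: 'o) =
      of_int ((-1) ^ j * (\<Sum>j'=1..j. int ((j - 1) choose (j' - 1)) * z j'))"
    using assms by (rule_tac power_op_coeff_eq)
  also have "\<dots> = (\<Sum>j'=1..j. of_int ((-1) ^ j * int ((j - 1) choose (j' - 1))) * of_int (z j'))"
    by (simp add: sum_distrib_left mult.assoc)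
  also have "\<dots> = (\<Sum>j'=1..j. of_int ((-1) ^ j * int ((j - 1) choose (j' - 1))) *
      power_op_coeff p m j' (- e))"
    using assms by (intro sum.cong) (auto simp: power_op_coeff_eq[OF assms(1,2) _ z])
  finally show ?thesis ..
qed

lemma branch2_add: "branch2 (f + g) = branch2 f + branch2 g"
  by transfer (auto intro: fps_ext)

lemma branch2_sum:
  fixes f :: "'i \<Rightarrow> 'b::comm_ring_1 node"
  shows "branch2 (sum f A) = (\<Sum>x\<in>A. branch2 (f x))"
proof -
  have "branch2 (0 :: 'b node) = 0" by transfer (auto intro: fps_ext)
  then show ?thesis by (induct A rule: infinite_finite_induct) (auto simp: branch2_add)
qed

lemma branch2_of_int_mult:
  fixes f :: "'a::comm_ring_1 node"
  shows "branch2 (of_int c * f) = of_int c * branch2 f"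
proof -
  have nat: "branch2 (of_nat n * g) = of_nat n * branch2 g" for n and g :: "'a node"
  proof (induct n)
    case 0
    show ?case by simp (transfer, auto intro: fps_ext)
  qed (simp add: branch2_add distrib_right)
  have uminus: "branch2 (- g) = - branch2 g" for g :: "'a node"
    by transfer (auto intro: fps_ext)
  show ?thesis
  proof (cases c)
    case (neg n)
    have "(of_int c :: 'a node) = - of_nat (Suc n)"
      by (simp only: neg of_int_minus of_int_of_nat_eq)
    then have "branch2 (of_int c * f) = branch2 (- (of_nat (Suc n) * f))"
      by (simp only: mult_minus_left)
    also have "\<dots> = of_int c * branch2 f" by (simp only: uminus nat neg of_int_minus of_int_of_nat_eq mult_minus_left)
    finally show ?thesis .
  qed (simp add: nat)
qed

lemma branch2_node_op_nth:
  "fps_nth (branch2 (node_op p m d j f)) k =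
     power_op_coeff p m j (- int k - d) * fps_nth (branch2 f) k"
  by transfer simp

lemma node_op_branch2:
  fixes f :: "'a::comm_ring_1 node"
  assumes "Factorial_Ring.prime p" "CHAR('a) = p" "d \<in> residues_mod p m" "0 < j" "j \<le> p ^ m"
  shows "branch2 (second_coord_op (node_op p m d) j f) =
    smooth_op p m (neg_mod p m d) j (branch2 f)"
proof (rule fps_ext)
  fix k
  have of_int_nth: "fps_nth (of_int c * h) k = of_int c * fps_nth h k" for c and h :: "'a fps"
    by (simp flip: fps_of_int)
  have "fps_nth (branch2 (second_coord_op (node_op p m d) j f)) k =
      (\<Sum>j' = 1..j. of_int ((-1) ^ j * int ((j - 1) choose (j' - 1))) *
         power_op_coeff p m j' (- (int k + d))) * fps_nth (branch2 f) k"
    by (simp only: second_coord_op_def branch2_sum branch2_of_int_mult fps_sum_nth of_int_nth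
        branch2_node_op_nth sum_distrib_right mult.assoc minus_add_distrib add_uminus_conv_diff)
  also have "\<dots> = power_op_coeff p m j (int k + d) * fps_nth (branch2 f) k"
    using assms by (subst power_op_coeff_minus) auto
  also have "(power_op_coeff p m j (int k + d) :: 'a) =
      power_op_coeff p m j (int k - neg_mod p m d)"
  proof (cases "d = 0")
    case False
    then have "neg_mod p m d = int p ^ (m + 1) - d"
      using assms(3) by (auto simp: neg_mod_def residues_mod_def zmod_zminus1_eq_if)
    then show ?thesis
      using power_op_coeff_add_period[OF assms(1,2,5), of "int k - neg_mod p m d"] by simp
  qed (simp add: neg_mod_def)
  finally show "fps_nth (branch2 (second_coord_op (node_op p m d) j f)) k =
      fps_nth (smooth_op p m (neg_mod p m d) j (branch2 f)) k"
    by (simp add: smooth_op_def)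
qed

end

theory Submission
  imports Defs "Jordan_Normal_Form.Determinant"
begin

text \<open>
  Write q for the integral part of j divided by the m-th power of p, and N for the (m+1)-st power
  of p. For j < N the factorial of q is invertible modulo p, and D j divided by it multiplies like
  the binomial coefficient function x \<mapsto> (x choose j). Flatness kills all D j with j \<ge> N, because D j is,
  up to a unit and terms of order between N and j, the product of D (j - N) and D N. Hence the
  functions on the integers modulo N act, and the indicator functions decompose the module into
  eigenspaces, called homogeneous parts below.

  The ring O is local. If a vector of a basis is the sum of its homogeneous components, then one of
  these components has an invertible coordinate at that vector and may replace it. So there is a
  basis of homogeneous elements; by the Leibniz rule and the Vandermonde identity each of them spans a
  copy of the module with exponent minus its degree. An isomorphism of two direct sums, read at the
  origin, is an invertible matrix whose entries vanish unless the two exponents agree; a nonzero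
  term of its determinant is a permutation that matches the exponents.
\<close>

section \<open>Arithmetic of the structure constants\<close>

text \<open>The rational value is an integer by \<open>gchoose_of_int\<close>, so the floor loses
  nothing. Upper arguments may be negative, and the values are to be reduced modulo p.\<close>

definition int_choose :: "int \<Rightarrow> nat \<Rightarrow> int"  (infix "ichoose" 64)
  where "e ichoose j = \<lfloor>of_int e gchoose j :: rat\<rfloor>"

lemma of_int_ichoose: "(of_int (e ichoose j) :: rat) = of_int e gchoose j"
proof -
  obtain z where z: "(of_int e gchoose j :: rat) = of_int z" by (rule gchoose_of_int)
  show ?thesis unfolding int_choose_def z by simp
qed

lemma int_choose_Vandermonde:
  "(a + b :: int) ichoose n = (\<Sum>k\<le>n. (a ichoose k) * (b ichoose (n - k)))"
proof -
  have "(of_int ((a + b) ichoose n) :: rat) = (of_int a + of_int b) gchoose n"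
    by (simp add: of_int_ichoose)
  also have "\<dots> = of_int (\<Sum>k\<le>n. (a ichoose k) * (b ichoose (n - k)))"
    by (simp add: of_int_ichoose atLeast0AtMost flip: gbinomial_Vandermonde)
  finally show ?thesis by (simp only: of_int_eq_iff)
qed

lemma int_choose_of_nat: "int n ichoose k = int (n choose k)"
proof -
  have "(of_int (int n ichoose k) :: rat) = of_int (int (n choose k))"
    by (simp add: of_int_ichoose flip: binomial_gbinomial)
  then show ?thesis by (simp only: of_int_eq_iff)
qed

text \<open>Binomial inversion: \<open>(l choose e) * (e choose j) = (l choose j) * ((l - j) choose
  (e - j))\<close> leaves an alternating row sum of Pascal's triangle, which vanishes unless
  \<open>l = j\<close>.\<close>

lemma alternating_choose_choose:
  fixes j l n :: nat
  assumes "l < n"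
  shows "(\<Sum>e<n. (-1) ^ (l + e) * int (l choose e) * int (e choose j)) = (if j = l then 1 else 0)"
proof (cases "j \<le> l")
  case False
  then have "(l choose e) * (e choose j) = 0" for e by (cases "e \<le> l") auto
  then have "int (l choose e) * int (e choose j) = 0" for e
    by (metis of_nat_0 of_nat_mult)
  then show ?thesis using False by (auto simp: mult.assoc intro!: sum.neutral)
next
  case True
  have "(\<Sum>e<n. (-1) ^ (l + e) * int (l choose e) * int (e choose j)) =
      (\<Sum>e\<in>{j..l}. (-1) ^ (l + e) * int (l choose e) * int (e choose j))"
    using assms by (intro sum.mono_neutral_right) (auto simp: not_le)
  also have "\<dots> = (\<Sum>i\<le>l - j. (-1) ^ (l + (j + i)) * int (l choose (j + i)) * int ((j + i) choose j))"
    using True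
    by (intro sum.reindex_bij_witness[where i = "\<lambda>i. j + i" and j = "\<lambda>e. e - j"]) auto
  also have "\<dots> = (\<Sum>i\<le>l - j. (-1) ^ (l + j) * int (l choose j) * ((-1) ^ i * int ((l - j) choose i)))"
  proof (intro sum.cong refl)
    fix i assume "i \<in> {..l - j}"
    then have "(l choose (j + i)) * ((j + i) choose j) = (l choose j) * ((l - j) choose i)"
      using choose_mult[of j "j + i" l] True by auto
    then have "int (l choose (j + i)) * int ((j + i) choose j) = int (l choose j) * int ((l - j) choose i)"
      by (metis of_nat_mult)
    then show "(-1) ^ (l + (j + i)) * int (l choose (j + i)) * int ((j + i) choose j) =
        (-1) ^ (l + j) * int (l choose j) * ((-1) ^ i * int ((l - j) choose i))"
      by (simp add: power_add algebra_simps)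
  qed
  also have "\<dots> = (-1) ^ (l + j) * int (l choose j) * (\<Sum>i\<le>l - j. (-1) ^ i * int ((l - j) choose i))"
    by (simp add: sum_distrib_left)
  also have "\<dots> = (if j = l then 1 else 0)"
    using True choose_alternating_sum[of "l - j", where 'a = int] by (auto simp flip: power_add mult_2)
  finally show ?thesis .
qed

text \<open>For \<open>j\<close> from \<open>max j' j''\<close> to \<open>j' + j''\<close> this is
  the multinomial factor of the product rule; it vanishes elsewhere. Without the guard, truncated
  subtraction would turn the second factor into 1 for \<open>j < j''\<close>.\<close>

definition choose_product_coeff :: "nat \<Rightarrow> nat \<Rightarrow> nat \<Rightarrow> nat" where
  "choose_product_coeff j' j'' j = (if j'' \<le> j then (j choose j') * (j' choose (j - j'')) else 0)"

text \<open>After \<open>(e choose j) * (j choose j') = (e choose j') * ((e - j') choose (j -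
  j'))\<close> a Vandermonde sum for \<open>e = j' + (e - j')\<close> remains. Terms with
  \<open>j > e\<close> vanish, so any bound \<open>n\<close> above \<open>e\<close> will do.\<close>

lemma choose_times_choose:
  assumes "e < n"
  shows "(e choose j') * (e choose j'') =
    (\<Sum>j<n. choose_product_coeff j' j'' j * (e choose j))"
proof (cases "j' \<le> e \<and> j'' \<le> e")
  case False
  have "choose_product_coeff j' j'' j * (e choose j) = 0" for j
    using False by (cases "j \<le> e") (auto simp: choose_product_coeff_def)
  then show ?thesis using False by (auto simp: binomial_eq_0)
next
  case True
  have "(\<Sum>j<n. choose_product_coeff j' j'' j * (e choose j)) =
      (\<Sum>j\<in>{j''..e}. choose_product_coeff j' j'' j * (e choose j))"
    using assms by (intro sum.mono_neutral_right) (auto simp: not_le choose_product_coeff_def)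
  also have "\<dots> = (\<Sum>k\<le>e - j''. choose_product_coeff j' j'' (j'' + k) * (e choose (j'' + k)))"
    using True
    by (intro sum.reindex_bij_witness[where i = "\<lambda>i. j'' + i" and j = "\<lambda>e. e - j''"]) auto
  also have "\<dots> = (\<Sum>k\<le>e - j''. (e choose j') * ((j' choose k) * ((e - j') choose (e - j'' - k))))"
  proof (intro sum.cong refl)
    fix k assume k: "k \<in> {..e - j''}"
    show "choose_product_coeff j' j'' (j'' + k) * (e choose (j'' + k)) =
      (e choose j') * ((j' choose k) * ((e - j') choose (e - j'' - k)))"
    proof (cases "j' \<le> j'' + k")
      case le: True
      then have "(e choose (j'' + k)) * ((j'' + k) choose j') = (e choose j') * ((e - j') choose (j'' + k - j'))"
        using choose_mult[of j' "j'' + k" e] True k by auto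
      moreover have "(e - j') choose (j'' + k - j') = (e - j') choose (e - j'' - k)"
      proof -
        have "e - j' - (j'' + k - j') = e - j'' - k" using True le k by auto
        then show ?thesis using binomial_symmetric[of "j'' + k - j'" "e - j'"] True le k by auto
      qed
      ultimately show ?thesis by (simp add: choose_product_coeff_def algebra_simps)
    next
      case False
      then have "e - j' < e - j'' - k" using True by auto
      then show ?thesis using False by (simp add: choose_product_coeff_def binomial_eq_0)
    qed
  qed
  also have "\<dots> = (e choose j') * (\<Sum>k\<le>e - j''. (j' choose k) * ((e - j') choose (e - j'' - k)))"
    by (simp add: sum_distrib_left)
  also have "\<dots> = (e choose j') * (e choose (e - j''))"
    using vandermonde[of j' "e - j'" "e - j''"] True by simp
  also have "\<dots> = (e choose j') * (e choose j'')"
    using True by (simp flip: binomial_symmetric)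
  finally show ?thesis ..
qed

section \<open>Divisibility by p of factorials and binomial coefficients\<close>

locale prime_level =
  fixes p m :: nat
  assumes prime_p: "Factorial_Ring.prime p"
begin

definition N :: nat where "N = p ^ (m + 1)"

abbreviation qf :: "nat \<Rightarrow> int" where "qf j \<equiv> fact (j div p ^ m)"

lemma p_gt_1: "p > 1" and p_pos: "p > 0" and pm_pos: "p ^ m > 0" and N_pos: "N > 0"
  using prime_gt_1_nat[OF prime_p] by (auto simp: N_def)

lemma N_eq: "N = p * p ^ m" by (simp add: N_def)

lemma not_dvd_qf: assumes "j < N" shows "\<not> int p dvd qf j"
proof -
  have "j div p ^ m < p" using assms by (simp add: N_eq less_mult_imp_div_less)
  then have "\<not> p dvd fact (j div p ^ m)" using prime_dvd_fact_iff[OF prime_p] by simp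
  then show ?thesis by (metis of_nat_dvd_iff of_nat_fact)
qed

lemma dvd_qf: assumes "j \<ge> N" shows "int p dvd qf j"
proof -
  have "j div p ^ m \<ge> p"
    using assms pm_pos by (simp add: N_eq less_eq_div_iff_mult_less_eq)
  then have "p dvd fact (j div p ^ m)" using prime_dvd_fact_iff[OF prime_p] by simp
  then show ?thesis by (metis of_nat_dvd_iff of_nat_fact)
qed

text \<open>Floors are superadditive, and a product of factorials divides the factorial of the sum.
  Hence the Leibniz constants are integers.\<close>

lemma qf_mult_dvd: "qf i * qf i' dvd qf (i + i')"
proof -
  have "(fact (i div p ^ m) * fact (i' div p ^ m) :: int) dvd fact (i div p ^ m + i' div p ^ m)"
    by (rule fact_fact_dvd_fact)
  also have "(fact (i div p ^ m + i' div p ^ m) :: int) dvd qf (i + i')"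
    by (intro fact_dvd) (subst div_add1_eq, simp)
  finally show ?thesis .
qed

lemma leibniz_coeff_eq: "leibniz_coeff p m i i' = of_int (qf (i + i') div (qf i * qf i'))"
proof -
  have "qf (i + i') = qf i * qf i' * (qf (i + i') div (qf i * qf i'))"
    using qf_mult_dvd by simp
  then have "(of_int (qf (i + i')) :: rat) = of_int (qf i) * of_int (qf i') * of_int (qf (i + i') div (qf i * qf i'))"
    by (metis of_int_mult)
  then show ?thesis by (simp add: leibniz_coeff_def qfact_def)
qed

text \<open>Passing from \<open>i\<close> to \<open>Suc i\<close> multiplies
  \<open>i choose N\<close> by \<open>Suc i / (Suc i - N)\<close>. If \<open>p ^ m\<close> divides
  \<open>Suc i\<close>, the other binomial coefficient grows by the same factor; otherwise that one
  does not change, and \<open>Suc i\<close> and \<open>Suc i - N\<close> have the same p-adic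
  valuation.\<close>

lemma choose_N_ratio:
  assumes "N \<le> j"
  shows "\<exists>u v. \<not> p dvd u \<and> \<not> p dvd v \<and> (j choose N) * u = (j div p ^ m choose p) * v"
  using assms
proof (induction j rule: dec_induct)
  case base
  have "N div p ^ m = p" using p_pos by (simp add: N_eq)
  moreover have "\<not> p dvd 1" using p_gt_1 by simp
  ultimately show ?case by (metis binomial_n_n)
next
  case (step i)
  then obtain u v where uv: "\<not> p dvd u" "\<not> p dvd v" "(i choose N) * u = (i div p ^ m choose p) * v"
    by blast
  have rec: "(Suc i - N) * (Suc i choose N) = Suc i * (i choose N)"
    using binomial_absorb_comp[of "Suc i" N] by simp
  show ?case
  proof (cases "p ^ m dvd Suc i")
    case True
    then obtain a where a: "Suc i = p ^ m * a" by (rule dvdE)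
    have ia: "Suc i div p ^ m = a" using a pm_pos by simp
    have ia': "i div p ^ m = a - 1" using div_Suc[of i "p ^ m"] True ia by (auto simp: dvd_eq_mod_eq_0)
    \<comment> \<open>Strict because \<open>i\<close> is at least \<open>N\<close>; this allows
      \<open>a - p\<close> to be cancelled.\<close>
    have "p ^ m * p < p ^ m * a"
      unfolding a[symmetric] using step.hyps by (simp add: N_eq mult.commute)
    then have "p < a" by simp
    have rec': "(a - p) * (a choose p) = a * ((a - 1) choose p)"
      by (rule binomial_absorb_comp)
    have d: "Suc i - N = p ^ m * (a - p)" by (simp add: a N_eq diff_mult_distrib mult.commute)
    have "p ^ m * (a - p) * ((Suc i choose N) * u) = (Suc i - N) * (Suc i choose N) * u" by (simp add: d)
    also have "\<dots> = p ^ m * a * ((i choose N) * u)" by (simp only: rec) (simp add: a)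
    also have "\<dots> = p ^ m * (a * ((a - 1) choose p)) * v" by (simp only: uv ia')
    also have "\<dots> = p ^ m * (a - p) * ((a choose p) * v)" by (simp only: rec'[symmetric])
    finally have "(Suc i choose N) * u = (a choose p) * v" using \<open>p < a\<close> pm_pos p_pos by simp
    then show ?thesis unfolding ia using uv(1,2) by blast
  next
    case False
    \<comment> \<open>Since \<open>s < m\<close>, subtracting \<open>N\<close> changes only the
      cofactor of \<open>p ^ s\<close>, from \<open>b\<close> to \<open>b'\<close>, and keeps it
      prime to p.\<close>
    define s where "s = multiplicity p (Suc i)"
    obtain b where b: "Suc i = p ^ s * b" "\<not> p dvd b"
      using multiplicity_decompose'[of "Suc i" p] prime_p p_gt_1 unfolding s_def
      by (metis nat.distinct(1) not_prime_unit)
    have "s < m" using False b(1) by (metis dvd_triv_left le_imp_power_dvd dvd_trans not_le)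
    then have Ns: "N = p ^ s * p ^ (m + 1 - s)" by (simp add: N_def flip: power_add)
    define b' where "b' = b - p ^ (m + 1 - s)"
    have d: "Suc i - N = p ^ s * b'" by (simp only: b(1) Ns b'_def diff_mult_distrib2)
    have "p ^ s * p ^ (m + 1 - s) \<le> p ^ s * b"
      unfolding b(1)[symmetric] Ns[symmetric] using step.hyps by simp
    then have le: "p ^ (m + 1 - s) \<le> b" using p_pos by (simp del: power_Suc)
    have "p dvd p ^ (m + 1 - s)" using \<open>s < m\<close> by (intro dvd_power) simp
    then have nb': "\<not> p dvd b'" using b(2) le unfolding b'_def by (meson dvd_diffD)
    have "p ^ s * ((Suc i choose N) * (b' * u)) = (Suc i - N) * (Suc i choose N) * u" by (simp add: d)
    also have "\<dots> = p ^ s * b * ((i choose N) * u)" by (simp only: rec) (simp add: b)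
    also have "\<dots> = p ^ s * ((i div p ^ m choose p) * (b * v))" by (simp only: uv) simp
    finally have "(Suc i choose N) * (b' * u) = (i div p ^ m choose p) * (b * v)" using p_pos by simp
    moreover have "Suc i div p ^ m = i div p ^ m"
      using False by (simp add: div_Suc dvd_eq_mod_eq_0)
    moreover have "\<not> p dvd b' * u" "\<not> p dvd b * v"
      using prime_dvd_mult_iff[OF prime_p] nb' b(2) uv by auto
    ultimately show ?thesis by (intro exI[of _ "b' * u"] exI[of _ "b * v"]) simp
  qed
qed

text \<open>As \<open>N div p ^ m = p\<close>, the constant of the top term is the quotient of the
  two binomial coefficients in \<open>choose_N_ratio\<close>, hence a unit at p.\<close>

lemma product_coeff_leading:
  assumes "N \<le> j"
  shows "\<exists>u v. \<not> int p dvd u \<and> \<not> int p dvd v \<and> product_coeff p m (j - N) N j * of_int u = of_int v"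
proof -
  obtain u v where uv: "\<not> p dvd u" "\<not> p dvd v" "(j choose N) * u = (j div p ^ m choose p) * v"
    using choose_N_ratio[OF assms] by blast
  have "N div p ^ m = p" using p_pos by (simp add: N_eq)
  have "p \<le> j div p ^ m" using assms pm_pos by (simp add: N_eq less_eq_div_iff_mult_less_eq)
  have "(j - N) div p ^ m = j div p ^ m - p"
    using div_mult_self3[of "p ^ m" p "j - N"] assms pm_pos by (simp add: N_eq del: div_mult_self3)
  then have c: "product_coeff p m (j - N) N j = of_nat (j choose N) / of_nat (j div p ^ m choose p)"
    using assms \<open>p \<le> j div p ^ m\<close> \<open>N div p ^ m = p\<close>
    by (simp add: product_coeff_def qfact_def binomial_fact field_simps)
  have "(of_nat (j choose N) * of_nat u :: rat) = of_nat (j div p ^ m choose p) * of_nat v"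
    using uv(3) by (metis of_nat_mult)
  then have "product_coeff p m (j - N) N j * of_int (int u) = of_int (int v)"
    using \<open>p \<le> j div p ^ m\<close> by (simp add: c)
  then show ?thesis using uv(1,2) by (metis of_nat_dvd_iff)
qed

text \<open>With the denominator cleared, the constant can be read modulo p whenever p does not
  divide \<open>qf j\<close>.\<close>

lemma product_coeff_eq:
  assumes "max j' j'' \<le> j" "j \<le> j' + j''"
  shows "product_coeff p m j' j'' j * of_int (qf j) =
    of_int (int (choose_product_coeff j' j'' j) * qf j' * qf j'')"
proof -
  have "of_nat (j choose j') = (fact j / (fact j' * fact (j - j')) :: rat)"
    using assms by (simp add: binomial_fact)
  moreover have "of_nat (j' choose (j - j'')) = (fact j' / (fact (j - j'') * fact (j' + j'' - j)) :: rat)"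
    using assms by (simp add: binomial_fact)
  ultimately show ?thesis
    using assms by (simp add: product_coeff_def choose_product_coeff_def qfact_def mult_ac)
qed

text \<open>A case of Lucas' theorem. For \<open>x = p ^ a + y\<close>, Vandermonde and the
  divisibility of the inner \<open>p ^ a choose k\<close> show that adding \<open>p ^ a\<close> to
  \<open>y\<close> adds 1 modulo p.\<close>

lemma choose_power_mod: "[x choose p ^ a = x div p ^ a] (mod p)"
proof (induction x rule: less_induct)
  case (less x)
  show ?case
  proof (cases "x < p ^ a")
    case True
    then show ?thesis by (simp add: binomial_eq_0)
  next
    case False
    then obtain y where x: "x = p ^ a + y" by (metis le_iff_add not_less)
    have pa: "p ^ a > 0" using p_pos by simp
    have "x choose p ^ a = (\<Sum>k\<le>p ^ a. (p ^ a choose k) * (y choose (p ^ a - k)))"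
      by (simp only: x vandermonde)
    also have "\<dots> = (\<Sum>k\<in>{0, p ^ a} \<union> {0<..<p ^ a}. (p ^ a choose k) * (y choose (p ^ a - k)))"
      by (intro sum.cong) auto
    also have "\<dots> = (y choose p ^ a) + 1 + (\<Sum>k\<in>{0<..<p ^ a}. (p ^ a choose k) * (y choose (p ^ a - k)))"
      using pa by (subst sum.union_disjoint) auto
    also have "[\<dots> = (y choose p ^ a) + 1 + 0] (mod p)"
    proof (intro cong_add cong_refl)
      have "p dvd (\<Sum>k\<in>{0<..<p ^ a}. (p ^ a choose k) * (y choose (p ^ a - k)))"
        using dvd_prime_power_choose[OF prime_p] by (intro dvd_sum) simp
      then show "[(\<Sum>k\<in>{0<..<p ^ a}. (p ^ a choose k) * (y choose (p ^ a - k))) = 0] (mod p)"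
        by (simp add: cong_0_iff)
    qed
    also have "[(y choose p ^ a) + 1 + 0 = y div p ^ a + 1] (mod p)"
      using less.IH[of y] cong_add[of "y choose p ^ a" "y div p ^ a" p 1 1] pa by (simp add: x)
    also have "y div p ^ a + 1 = x div p ^ a" using pa by (simp add: x)
    finally show ?thesis .
  qed
qed

end

section \<open>Structure constants in a ring of characteristic p\<close>

lemma of_int_eq_if_cong:
  assumes "CHAR('o::comm_ring_1) = p" "[a = b] (mod int p)"
  shows "(of_int a :: 'o) = of_int b"
  using assms by (simp add: of_int_eq_iff_cong_CHAR)

lemma of_int_unit:
  assumes "Factorial_Ring.prime p" "CHAR('o::comm_ring_1) = p" "\<not> int p dvd b"
  shows "of_int (modular_inverse (int p) b) * of_int b = (1 :: 'o)"
proof -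
  have "coprime b (int p)"
    using assms(1,3) prime_imp_coprime[of "int p" b] by (simp add: coprime_commute)
  then have "cong (modular_inverse (int p) b * b) 1 (int p)"
    by (metis cong_modular_inverse1 mult.commute)
  then show ?thesis using of_int_eq_if_cong[OF assms(2)] by (metis of_int_1 of_int_mult)
qed

text \<open>Evaluates \<open>zp_reduce\<close> from any fraction whose denominator \<open>b\<close>
  is prime to p: the reduced denominator divides \<open>b\<close>, so its modular inverse is an
  inverse in the ring.\<close>

lemma zp_reduce_mult_of_int:
  assumes "Factorial_Ring.prime p" "CHAR('o::comm_ring_1) = p"
    and "\<not> int p dvd b" "c * of_int b = of_int a"
  shows "zp_reduce p c * of_int b = (of_int a :: 'o)"
proof -
  obtain x y where xy: "quotient_of c = (x, y)" by (cases "quotient_of c")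
  have "coprime x y" and y: "y > 0" and c: "c = of_int x / of_int y"
    using xy quotient_of_coprime quotient_of_denom_pos quotient_of_div by auto
  have "(of_int (x * b) :: rat) = of_int (a * y)" using assms(4) y by (simp add: c field_simps)
  then have eq: "x * b = a * y" by (simp only: of_int_eq_iff)
  have "y dvd b" using \<open>coprime x y\<close> eq by (metis coprime_commute coprime_dvd_mult_right_iff dvd_triv_right)
  then have "\<not> int p dvd y" using assms(3) dvd_trans by blast
  then have u: "of_int (modular_inverse (int p) y) * of_int y = (1 :: 'o)"
    by (rule of_int_unit[OF assms(1,2)])
  have "zp_reduce p c * of_int b = of_int (modular_inverse (int p) y) * (of_int (x * b) :: 'o)"
    by (simp add: zp_reduce_def xy mult_ac)
  also have "\<dots> = of_int (modular_inverse (int p) y) * of_int y * (of_int a :: 'o)"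
    by (simp only: eq of_int_mult) (simp only: mult_ac)
  finally show ?thesis by (simp add: u)
qed

locale char_prime_level = prime_level +
  fixes ring_type :: "'o::comm_ring_1 itself"
  assumes CHAR_p: "CHAR('o) = p"
begin

lemma power_op_coeff_int: "(power_op_coeff p m j e :: 'o) = of_int (qf j * (e ichoose j))"
proof -
  have "qfact p m j * (of_int e gchoose j) = of_int (qf j * (e ichoose j))"
    by (simp add: qfact_def of_int_ichoose)
  then show ?thesis
    unfolding power_op_coeff_def using zp_reduce_of_int[OF prime_p CHAR_p] by metis
qed

lemma power_op_coeff_nat: "(power_op_coeff p m j (int e) :: 'o) = of_int (qf j * int (e choose j))"
  by (simp add: power_op_coeff_int int_choose_of_nat)

lemma of_int_qf_eq_0: "N \<le> j \<Longrightarrow> (of_int (qf j) :: 'o) = 0"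
  by (rule of_int_zero_if_dvd[OF CHAR_p dvd_qf])

lemma power_op_coeff_eq_0: "N \<le> j \<Longrightarrow> (power_op_coeff p m j e :: 'o) = 0"
  using of_int_qf_eq_0 by (simp only: power_op_coeff_int of_int_mult mult_zero_left)

text \<open>For \<open>j < N\<close> all \<open>N choose k\<close> with \<open>0 < k \<le> j\<close>
  are divisible by p, so Vandermonde leaves the term \<open>k = 0\<close>; for larger
  \<open>j\<close> both sides are 0.\<close>

lemma power_op_coeff_periodic: "(power_op_coeff p m j (e + int N) :: 'o) = power_op_coeff p m j e"
proof (cases "j < N")
  case True
  have "[(int N + e) ichoose j = e ichoose j] (mod int p)"
  proof -
    have "(int N + e) ichoose j = (\<Sum>k\<le>j. int (N choose k) * (e ichoose (j - k)))"
      by (simp add: int_choose_Vandermonde int_choose_of_nat)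
    also have "\<dots> = (e ichoose j) + (\<Sum>k\<in>{0<..j}. int (N choose k) * (e ichoose (j - k)))"
      by (subst sum.remove[of _ 0]) (auto intro!: sum.cong)
    also have "[\<dots> = (e ichoose j) + 0] (mod int p)"
    proof (intro cong_add cong_refl)
      have "int p dvd (\<Sum>k\<in>{0<..j}. int (N choose k) * (e ichoose (j - k)))"
        using True dvd_prime_power_choose[OF prime_p, of _ "m + 1"]
        by (intro dvd_sum dvd_mult2) (simp add: N_def del: power_Suc)
      then show "[(\<Sum>k\<in>{0<..j}. int (N choose k) * (e ichoose (j - k))) = 0] (mod int p)"
        by (simp add: cong_0_iff)
    qed
    finally show ?thesis by simp
  qed
  then have "[qf j * ((int N + e) ichoose j) = qf j * (e ichoose j)] (mod int p)"
    by (rule cong_scalar_left)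
  then show ?thesis unfolding power_op_coeff_int by (subst add.commute, intro of_int_eq_if_cong[OF CHAR_p])
next
  case False
  then show ?thesis by (simp add: power_op_coeff_eq_0)
qed

lemma power_op_coeff_neg_mod:
  assumes "d \<in> residues_mod p m"
  shows "(power_op_coeff p m j (- d) :: 'o) = power_op_coeff p m j (neg_mod p m d)"
proof (cases "d = 0")
  case False
  then have "neg_mod p m d = - d + int N"
    using assms by (auto simp: neg_mod_def residues_mod_def zmod_zminus1_eq_if N_def)
  then show ?thesis by (simp only: power_op_coeff_periodic)
qed (simp add: neg_mod_def)

lemma neg_mod_less: "neg_mod p m d \<in> {0..<int N}"
proof -
  have "neg_mod p m d = (- d) mod int N" by (simp add: neg_mod_def N_def)
  then show ?thesis using N_pos by simp
qed

text \<open>For \<open>a \<le> m\<close> the factorial is 1, and \<open>x choose p ^ a\<close> is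
  congruent to \<open>x div p ^ a\<close>, whose class modulo p is the digit.\<close>

lemma power_op_coeff_digit:
  assumes "d \<in> residues_mod p m" "a \<le> m"
  shows "(power_op_coeff p m (p ^ a) (- d) :: 'o) = of_int (digit p a (neg_mod p m d))"
proof -
  define x where "x = nat (neg_mod p m d)"
  have x: "neg_mod p m d = int x" using neg_mod_less by (simp add: x_def)
  have "p ^ a div p ^ m \<le> 1"
    using div_le_mono[of "p ^ a" "p ^ m" "p ^ m"] power_increasing[OF assms(2), of p] p_pos by simp
  then have "qf (p ^ a) = 1" by (metis fact_0 fact_1 le_SucE One_nat_def le_zero_eq)
  then have "(power_op_coeff p m (p ^ a) (- d) :: 'o) = of_int (int (x choose p ^ a))"
    by (simp add: power_op_coeff_neg_mod[OF assms(1)] x power_op_coeff_nat)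
  also have "\<dots> = of_int (digit p a (int x))"
  proof (intro of_int_eq_if_cong[OF CHAR_p])
    have "[int (x choose p ^ a) = int (x div p ^ a)] (mod int p)"
      using choose_power_mod by (simp only: cong_int_iff)
    then show "[int (x choose p ^ a) = digit p a (int x)] (mod int p)"
      by (simp add: digit_def cong_def zdiv_int)
  qed
  finally show ?thesis by (simp add: x)
qed

text \<open>Of two degrees \<open>x < y < N\<close>, the coefficient of order \<open>y\<close> is 0
  at the first and the unit \<open>qf y\<close> at the second. A unit is required since
  \<open>a\<close> may be a zero divisor.\<close>

lemma power_op_coeff_separates:
  fixes a :: 'o
  assumes "d \<in> residues_mod p m" "d' \<in> residues_mod p m" "a \<noteq> 0"
    and "\<And>j. power_op_coeff p m j (- d) * a = power_op_coeff p m j (- d') * a"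
  shows "d = d'"
proof -
  have *: "\<not> x < y" if "y < N"
    and "\<And>j. power_op_coeff p m j (int x) * a = power_op_coeff p m j (int y) * a" for x y
  proof
    assume "x < y"
    then have "of_int (qf y) * a = 0"
      using that(2)[of y] by (simp add: power_op_coeff_nat binomial_eq_0)
    moreover have "of_int (modular_inverse (int p) (qf y)) * of_int (qf y) = (1 :: 'o)"
      using that(1) by (intro of_int_unit[OF prime_p CHAR_p] not_dvd_qf)
    ultimately show False using \<open>a \<noteq> 0\<close> by (metis mult.assoc mult_1 mult_zero_right)
  qed
  obtain x y where x: "neg_mod p m d = int x" and y: "neg_mod p m d' = int y" and "x < N" "y < N"
    using neg_mod_less[of d] neg_mod_less[of d'] by (metis atLeastLessThan_iff of_nat_less_iff zero_le_imp_eq_int)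
  have "power_op_coeff p m j (int x) * a = power_op_coeff p m j (int y) * a" for j
    using assms(4)[of j] by (simp add: power_op_coeff_neg_mod assms x y)
  then have "x = y" using *[of x y] *[of y x] \<open>x < N\<close> \<open>y < N\<close> by (metis linorder_neqE_nat)
  then have "(- d) mod int N = (- d') mod int N" using x y by (simp add: neg_mod_def N_def)
  then have "d mod int N = d' mod int N" by (metis minus_equation_iff mod_minus_cong)
  then show ?thesis using assms(1,2) by (simp add: residues_mod_def N_def)
qed

text \<open>The Leibniz constants absorb the factorials of \<open>i\<close> and \<open>j - i\<close>
  into that of \<open>j\<close>; what remains is Vandermonde. So degrees add under
  multiplication.\<close>

lemma leibniz_Vandermonde:
  "(\<Sum>i\<le>j. zp_reduce p (leibniz_coeff p m i (j - i)) * power_op_coeff p m i x * power_op_coeff p m (j - i) y) =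
   (power_op_coeff p m j (x + y) :: 'o)"
proof -
  have "(\<Sum>i\<le>j. zp_reduce p (leibniz_coeff p m i (j - i)) * power_op_coeff p m i x * power_op_coeff p m (j - i) y) =
      (\<Sum>i\<le>j. of_int (qf j * ((x ichoose i) * (y ichoose (j - i)))) :: 'o)"
  proof (intro sum.cong refl)
    fix i assume i: "i \<in> {..j}"
    define L where "L = qf j div (qf i * qf (j - i))"
    have L: "qf j = L * (qf i * qf (j - i))"
      unfolding L_def using i qf_mult_dvd[of i "j - i"] by simp
    have "zp_reduce p (leibniz_coeff p m i (j - i)) = (of_int L :: 'o)"
      using i by (simp add: leibniz_coeff_eq L_def zp_reduce_of_int[OF prime_p CHAR_p])
    then show "zp_reduce p (leibniz_coeff p m i (j - i)) * power_op_coeff p m i x * power_op_coeff p m (j - i) y =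
       (of_int (qf j * ((x ichoose i) * (y ichoose (j - i)))) :: 'o)"
      by (simp only: power_op_coeff_int L flip: of_int_mult) (simp only: mult_ac)
  qed
  also have "\<dots> = of_int (qf j * (\<Sum>i\<le>j. (x ichoose i) * (y ichoose (j - i))))"
    by (simp only: sum_distrib_left of_int_sum)
  finally show ?thesis by (simp only: power_op_coeff_int int_choose_Vandermonde)
qed

end

section \<open>Frames of a module over a local ring\<close>

locale framed_module = Modules.module scale
  for scale :: "'a::comm_ring_1 \<Rightarrow> 'b::ab_group_add \<Rightarrow> 'b"
begin

definition frame_comb :: "nat \<Rightarrow> (nat \<Rightarrow> 'b) \<Rightarrow> (nat \<Rightarrow> 'a) \<Rightarrow> 'b" where
  "frame_comb n w c = (\<Sum>i<n. scale (c i) (w i))"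

text \<open>Bases are indexed so that one vector can be exchanged and an exponent attached to each
  index. Values of \<open>w\<close> and \<open>c\<close> from \<open>n\<close> on are
  irrelevant.\<close>

definition is_frame :: "nat \<Rightarrow> (nat \<Rightarrow> 'b) \<Rightarrow> bool" where
  "is_frame n w \<longleftrightarrow> (\<forall>x. \<exists>c. x = frame_comb n w c) \<and>
     (\<forall>c. frame_comb n w c = 0 \<longrightarrow> (\<forall>i<n. c i = 0))"

lemma frame_comb_add: "frame_comb n w (\<lambda>i. c i + d i) = frame_comb n w c + frame_comb n w d"
  by (simp add: frame_comb_def scale_left_distrib sum.distrib)

lemma frame_comb_diff: "frame_comb n w (\<lambda>i. c i - d i) = frame_comb n w c - frame_comb n w d"
  by (simp add: frame_comb_def scale_left_diff_distrib sum_subtractf)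

lemma frame_comb_scale: "frame_comb n w (\<lambda>i. r * c i) = scale r (frame_comb n w c)"
  by (simp add: frame_comb_def scale_sum_right)

lemma frame_comb_sum: "frame_comb n w (\<lambda>i. \<Sum>e\<in>A. c e i) = (\<Sum>e\<in>A. frame_comb n w (c e))"
  unfolding frame_comb_def scale_sum_left by (rule sum.swap)

lemma frame_comb_unit:
  assumes "k < n"
  shows "frame_comb n w (\<lambda>i. if i = k then 1 else 0) = w k"
proof -
  have "frame_comb n w (\<lambda>i. if i = k then 1 else 0) = (\<Sum>i<n. if i = k then w k else 0)"
    unfolding frame_comb_def by (intro sum.cong refl) simp
  then show ?thesis using assms by simp
qed

lemma frame_comb_cong: "(\<And>i. i < n \<Longrightarrow> c i = d i) \<Longrightarrow> frame_comb n w c = frame_comb n w d"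
  by (simp add: frame_comb_def)

lemma frame_comb_inj:
  assumes "is_frame n w" "frame_comb n w c = frame_comb n w d" "i < n"
  shows "c i = d i"
proof -
  have "frame_comb n w (\<lambda>i. c i - d i) = 0" using assms(2) by (simp add: frame_comb_diff)
  then have "c i - d i = 0" using assms unfolding is_frame_def by blast
  then show ?thesis by simp
qed

lemma free_of_rank_frame:
  assumes "free_of_rank n scale"
  obtains w where "is_frame n w"
proof -
  obtain B where B: "finite B" "card B = n" "independent B" "span B = UNIV"
    using assms unfolding free_of_rank_def by blast
  obtain w where w: "bij_betw w {..<n} B"
    using ex_bij_betw_nat_finite[OF B(1)] B(2) by (auto simp: atLeast0LessThan)
  have reindex: "(\<Sum>v\<in>B. scale (u v) v) = frame_comb n w (u \<circ> w)" for u
    unfolding frame_comb_def by (simp add: sum.reindex_bij_betw[OF w, symmetric])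
  have "is_frame n w"
    unfolding is_frame_def
  proof (intro conjI allI impI)
    fix x
    have "x \<in> range (\<lambda>u. \<Sum>v\<in>B. scale (u v) v)" using B(4) span_finite[OF B(1)] by auto
    then show "\<exists>c. x = frame_comb n w c" using reindex by auto
  next
    fix c i assume c: "frame_comb n w c = 0" and "i < n"
    define u where "u = c \<circ> inv_into {..<n} w"
    have u: "u (w i) = c i" if "i < n" for i
      using that w by (simp add: u_def bij_betw_inv_into_left)
    then have "frame_comb n w (u \<circ> w) = frame_comb n w c" by (intro frame_comb_cong) simp
    then have "(\<Sum>v\<in>B. scale (u v) v) = 0" using c reindex by simp
    then have "\<forall>v\<in>B. u v = 0" using B(3) dependent_finite[OF B(1)] by blast
    then show "c i = 0" using u[OF \<open>i < n\<close>] bij_betwE[OF w] \<open>i < n\<close> by force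
  qed
  then show ?thesis by (rule that)
qed

text \<open>The matrix from new to old coordinates is the identity except for column
  \<open>k\<close>, which is \<open>c\<close> and has the unit \<open>c k\<close> on the diagonal;
  so it is invertible.\<close>

lemma is_frame_exchange:
  assumes "is_frame n w" "k < n" "x = frame_comb n w c" "u * c k = 1"
  shows "is_frame n (w(k := x))"
proof -
  have comb: "frame_comb n (w(k := x)) b =
      frame_comb n w (\<lambda>i. if i = k then b k * c k else b i + b k * c i)" for b
  proof -
    have "frame_comb n (w(k := x)) b = scale (b k) x + (\<Sum>i\<in>{..<n} - {k}. scale (b i) (w i))"
      unfolding frame_comb_def using assms(2) by (subst sum.remove[of _ k]) auto
    also have "scale (b k) x = scale (b k * c k) (w k) + (\<Sum>i\<in>{..<n} - {k}. scale (b k * c i) (w i))"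
      unfolding assms(3) frame_comb_def using assms(2)
      by (subst sum.remove[of _ k]) (auto simp: scale_right_distrib scale_sum_right)
    also have "\<dots> + (\<Sum>i\<in>{..<n} - {k}. scale (b i) (w i)) =
        scale (b k * c k) (w k) + (\<Sum>i\<in>{..<n} - {k}. scale (b i + b k * c i) (w i))"
      by (simp add: scale_left_distrib sum.distrib algebra_simps)
    also have "\<dots> = frame_comb n w (\<lambda>i. if i = k then b k * c k else b i + b k * c i)"
      unfolding frame_comb_def using assms(2) by (subst (2) sum.remove[of _ k]) auto
    finally show ?thesis .
  qed
  show ?thesis
    unfolding is_frame_def
  proof (intro conjI allI impI)
    fix y
    obtain a where a: "y = frame_comb n w a" using assms(1) unfolding is_frame_def by blast
    have "a k * u * c k = a k" using assms(4) by (simp add: mult.assoc)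
    \<comment> \<open>The witness solves the formula \<open>comb\<close> for \<open>b\<close>: first
      \<open>b k = a k * u\<close>, then the other entries by subtraction.\<close>
    then have "y = frame_comb n (w(k := x)) (\<lambda>i. if i = k then a k * u else a i - a k * u * c i)"
      unfolding comb a by (intro frame_comb_cong) auto
    then show "\<exists>b. y = frame_comb n (w(k := x)) b" by blast
  next
    fix b i assume b: "frame_comb n (w(k := x)) b = 0" and "i < n"
    then have *: "\<forall>i<n. (if i = k then b k * c k else b i + b k * c i) = 0"
      using assms(1) unfolding comb is_frame_def by blast
    then have "b k * c k = 0" using assms(2) by auto
    then have "b k * (u * c k) = 0" by (simp add: mult.left_commute)
    then have "b k = 0" using assms(4) by simp
    then show "b i = 0" using * \<open>i < n\<close> by (cases "i = k") auto
  qed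
qed

lemma frame_bij_betw:
  assumes "is_frame n w"
  shows "bij_betw (frame_comb n w) (dsum_carrier n) UNIV"
  unfolding bij_betw_def
proof
  show "inj_on (frame_comb n w) (dsum_carrier n)"
  proof (intro inj_onI ext)
    fix c d i assume "c \<in> dsum_carrier n" "d \<in> dsum_carrier n" "frame_comb n w c = frame_comb n w d"
    then show "c i = d i"
      using frame_comb_inj[OF assms] by (cases "i < n") (auto simp: dsum_carrier_def)
  qed
  have "x \<in> frame_comb n w ` dsum_carrier n" for x
  proof -
    obtain c where "x = frame_comb n w c" using assms unfolding is_frame_def by blast
    also have "\<dots> = frame_comb n w (\<lambda>i. if i < n then c i else 0)"
      by (rule frame_comb_cong) simp
    finally show ?thesis by (auto simp: dsum_carrier_def)
  qed
  then show "frame_comb n w ` dsum_carrier n = UNIV" by blast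
qed

end

text \<open>Locality for two summands extends by induction; the empty sum is not a unit because
  \<open>0 \<noteq> 1\<close>.\<close>

lemma sum_unit_local:
  fixes f :: "'i \<Rightarrow> 'o::comm_ring_1"
  assumes local: "\<And>x y :: 'o. x + y dvd 1 \<Longrightarrow> x dvd 1 \<or> y dvd 1"
    and "finite A" "sum f A dvd 1"
  shows "\<exists>i\<in>A. f i dvd 1"
  using assms(2,3)
proof (induction A rule: finite_induct)
  case (insert i A)
  then show ?case using local[of "f i" "sum f A"] by auto
qed simp

section \<open>The decomposition of a flat module into homogeneous parts\<close>

context diff_op_module
begin

lemma D_zero: "D j 0 = 0"
  using D_add[of j 0 0] by simp

lemma D_uminus: "D j (- v) = - D j v"
proof -
  have "D j v + D j (- v) = 0" using D_add[of j v "- v"] by (simp add: D_zero)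
  then show ?thesis by (metis minus_unique)
qed

lemma D_sum: "D j (sum f A) = (\<Sum>i\<in>A. D j (f i))"
  by (induction A rule: infinite_finite_induct) (auto simp: D_zero D_add)

text \<open>Additivity suffices for integer scalars. \<open>D j\<close> need not be linear over the
  ring, but the constants that have to pass through it below are images of integers.\<close>

lemma D_of_int: "D j (scale (of_int z) v) = scale (of_int z) (D j v)"
proof -
  have nat: "D j (scale (of_nat n) v) = scale (of_nat n) (D j v)" for n
    by (induction n) (auto simp: D_zero D_add scale_left_distrib)
  show ?thesis
  proof (cases z)
    case (neg n)
    then have "scale (of_int z) x = - scale (of_nat (Suc n)) x" for x
      by (simp only: of_int_minus of_int_of_nat_eq scale_minus_left)
    then show ?thesis by (simp only: D_uminus nat)
  qed (simp add: nat)
qed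

end

locale flat_diff_op_module = char_prime_level p m "TYPE('o)" + diff_op_module p m DO scale D +
  framed_module scale
  for p m :: nat and DO :: "nat \<Rightarrow> 'o::comm_ring_1 \<Rightarrow> 'o"
    and scale :: "'o \<Rightarrow> 'f::ab_group_add \<Rightarrow> 'f" and D +
  assumes flat_D: "flat p m D"
begin

lemma D_eq_0:
  assumes "N \<le> j"
  shows "D j v = 0"
  using assms
proof (induction j rule: less_induct)
  case (less j)
  have "D N v = 0" using flat_D by (simp add: flat_def N_def)
  then have "0 = D (j - N) (D N v)" by (simp add: D_zero)
  also have "\<dots> = (\<Sum>i = max (j - N) N..j. scale (zp_reduce p (product_coeff p m (j - N) N i)) (D i v))"
    using less.prems by (simp add: D_D)
  \<comment> \<open>All indices are at least \<open>N\<close>, so the terms below \<open>j\<close>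
    vanish by the induction hypothesis.\<close>
  also have "\<dots> = (\<Sum>i\<in>{j}. scale (zp_reduce p (product_coeff p m (j - N) N i)) (D i v))"
    using less by (intro sum.mono_neutral_right) auto
  finally have 0: "scale (zp_reduce p (product_coeff p m (j - N) N j)) (D j v) = 0" by simp
  obtain x y where xy: "\<not> int p dvd x" "\<not> int p dvd y"
    "product_coeff p m (j - N) N j * of_int x = of_int y"
    using product_coeff_leading[OF less.prems] by blast
  have "D j v = scale (of_int (modular_inverse (int p) y) * of_int y) (D j v)"
    by (simp add: of_int_unit[OF prime_p CHAR_p xy(2)])
  also have "(of_int y :: 'o) = of_int x * zp_reduce p (product_coeff p m (j - N) N j)"
    using zp_reduce_mult_of_int[OF prime_p CHAR_p xy(1,3)] by (simp add: mult.commute)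
  also have "scale (of_int (modular_inverse (int p) y) * \<dots>) (D j v) = 0"
    by (simp add: 0 flip: scale_scale)
  finally show ?case .
qed

definition inv_qf :: "nat \<Rightarrow> int" where "inv_qf j = modular_inverse (int p) (qf j)"

lemma inv_qf: "j < N \<Longrightarrow> of_int (inv_qf j) * of_int (qf j) = (1 :: 'o)"
  unfolding inv_qf_def by (intro of_int_unit[OF prime_p CHAR_p] not_dvd_qf)

text \<open>The operator that corresponds to the binomial coefficient of the logarithmic derivation.\<close>

definition Binom :: "nat \<Rightarrow> 'f \<Rightarrow> 'f" where
  "Binom j v = scale (of_int (inv_qf j)) (D j v)"

lemma D_eq_Binom: "j < N \<Longrightarrow> D j v = scale (of_int (qf j)) (Binom j v)"
  using inv_qf[of j] by (simp add: Binom_def mult.commute)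

lemma Binom_sum: "Binom j (sum f A) = (\<Sum>i\<in>A. Binom j (f i))"
  by (simp add: Binom_def D_sum scale_sum_right)

lemma Binom_of_int: "Binom j (scale (of_int z) v) = scale (of_int z) (Binom j v)"
  by (simp add: Binom_def D_of_int mult.commute)

lemma Binom_0: "Binom 0 v = v"
  using D_eq_Binom[OF N_pos, of v] D_0[of v] by simp

text \<open>Dividing by the factorials turns the product rule into the multiplication table of the
  functions \<open>x choose j\<close>. Orders from \<open>N\<close> on drop out by
  \<open>D_eq_0\<close>; below \<open>N\<close> all \<open>j\<close> may be summed, since
  \<open>choose_product_coeff\<close> vanishes outside the range of the rule.\<close>

lemma Binom_Binom:
  assumes "j' < N" "j'' < N"
  shows "Binom j' (Binom j'' v) =
    (\<Sum>j<N. scale (of_int (int (choose_product_coeff j' j'' j))) (Binom j v))"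
proof -
  have "Binom j' (Binom j'' v) = scale (of_int (inv_qf j') * of_int (inv_qf j'')) (D j' (D j'' v))"
    by (simp add: Binom_def D_of_int)
  also have "\<dots> = (\<Sum>j = max j' j''..j' + j''.
      scale (of_int (inv_qf j') * of_int (inv_qf j'') * zp_reduce p (product_coeff p m j' j'' j)) (D j v))"
    by (simp add: D_D scale_sum_right mult.assoc)
  also have "\<dots> = (\<Sum>j\<in>{max j' j''..j' + j''} \<inter> {..<N}.
      scale (of_int (int (choose_product_coeff j' j'' j))) (Binom j v))"
  proof (intro sum.mono_neutral_cong_right ballI)
    fix j assume j: "j \<in> {max j' j''..j' + j''} \<inter> {..<N}"
    have zp: "zp_reduce p (product_coeff p m j' j'' j) * of_int (qf j) =
        (of_int (int (choose_product_coeff j' j'' j) * qf j' * qf j'') :: 'o)"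
      using j by (intro zp_reduce_mult_of_int[OF prime_p CHAR_p] not_dvd_qf product_coeff_eq) auto
    have "of_int (inv_qf j') * of_int (inv_qf j'') * zp_reduce p (product_coeff p m j' j'' j) * of_int (qf j) =
        of_int (int (choose_product_coeff j' j'' j)) *
        (of_int (inv_qf j') * of_int (qf j')) * (of_int (inv_qf j'') * of_int (qf j'') :: 'o)"
      by (simp only: mult.assoc zp of_int_mult) (simp only: mult_ac)
    then have "of_int (inv_qf j') * of_int (inv_qf j'') * zp_reduce p (product_coeff p m j' j'' j) * of_int (qf j) =
        (of_int (int (choose_product_coeff j' j'' j)) :: 'o)"
      by (simp only: inv_qf assms mult_1_right)
    then show "scale (of_int (inv_qf j') * of_int (inv_qf j'') * zp_reduce p (product_coeff p m j' j'' j)) (D j v) =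
        scale (of_int (int (choose_product_coeff j' j'' j))) (Binom j v)"
      using j by (subst D_eq_Binom) (auto simp only: scale_scale Int_iff lessThan_iff)
  qed (auto simp: D_eq_0)
  also have "\<dots> = (\<Sum>j<N. scale (of_int (int (choose_product_coeff j' j'' j))) (Binom j v))"
  proof (intro sum.mono_neutral_left ballI)
    fix j assume "j \<in> {..<N} - {max j' j''..j' + j''} \<inter> {..<N}"
    then have "j < j' \<or> j < j'' \<or> j' + j'' < j" by auto
    then have "choose_product_coeff j' j'' j = 0"
      by (auto simp: choose_product_coeff_def binomial_eq_0)
    then show "scale (of_int (int (choose_product_coeff j' j'' j))) (Binom j v) = 0" by simp
  qed auto
  finally show ?thesis .
qed

text \<open>Binomial inversion: the operator of the indicator function of e modulo N.\<close>

definition Proj :: "nat \<Rightarrow> 'f \<Rightarrow> 'f" where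
  "Proj e v = (\<Sum>j<N. scale (of_int ((-1) ^ (j + e) * int (j choose e))) (Binom j v))"

text \<open>A function on \<open>{..<N}\<close>, here \<open>x choose j\<close>, is the sum of its
  values times the indicator functions. Exchanging the sums reduces this to
  \<open>alternating_choose_choose\<close>.\<close>

lemma Binom_eq_sum_Proj:
  assumes "j < N"
  shows "Binom j v = (\<Sum>e<N. scale (of_int (int (e choose j))) (Proj e v))"
proof -
  have "(\<Sum>e<N. scale (of_int (int (e choose j))) (Proj e v)) =
      (\<Sum>e<N. \<Sum>l<N. scale (of_int ((-1) ^ (l + e) * int (l choose e) * int (e choose j))) (Binom l v))"
    unfolding Proj_def scale_sum_right scale_scale of_int_mult[symmetric]
    by (simp only: mult.commute)
  also have "\<dots> = (\<Sum>l<N. scale (of_int (\<Sum>e<N. (-1) ^ (l + e) * int (l choose e) * int (e choose j))) (Binom l v))"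
    unfolding of_int_sum scale_sum_left by (rule sum.swap)
  also have "\<dots> = (\<Sum>l<N. scale (of_int (if j = l then 1 else 0)) (Binom l v))"
    by (intro sum.cong refl) (simp only: alternating_choose_choose lessThan_iff)
  also have "\<dots> = (\<Sum>l<N. if j = l then Binom j v else 0)"
    by (intro sum.cong refl) auto
  also have "\<dots> = Binom j v" using assms by simp
  finally show ?thesis ..
qed

lemma sum_Proj: "(\<Sum>e<N. Proj e v) = v"
  using Binom_eq_sum_Proj[OF N_pos, of v] by (simp add: Binom_0)

text \<open>A function times the indicator of \<open>e'\<close> is its value at \<open>e'\<close>
  times that indicator, and the operators multiply like functions on \<open>{..<N}\<close> by
  \<open>Binom_Binom\<close> and \<open>choose_times_choose\<close>.\<close>

lemma Binom_Proj:
  assumes "j' < N" "e' < N"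
  shows "Binom j' (Proj e' v) = scale (of_int (int (e' choose j'))) (Proj e' v)"
proof -
  define s where "s j = (-1) ^ (j + e') * int (j choose e')" for j
  \<comment> \<open>The numbers \<open>s j\<close> expand the indicator of \<open>e'\<close> in the
    binomial functions; this sum is its value at \<open>e\<close>.\<close>
  have inversion: "(\<Sum>j<N. s j * int (e choose j)) = (if e = e' then 1 else 0)" if "e < N" for e
  proof -
    \<comment> \<open>Brings \<open>e\<close> into the sign so that
      \<open>alternating_choose_choose\<close> applies to row \<open>e\<close>; the extra sign is 1
      in the surviving case \<open>e = e'\<close>.\<close>
    have sign: "(-1) ^ (j + e') = (-1) ^ (e + e') * (-1 :: int) ^ (e + j)" for j
      by (cases "even e"; cases "even e'"; cases "even j") auto
    have "s j * int (e choose j) =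
        (-1) ^ (e + e') * ((-1) ^ (e + j) * int (e choose j) * int (j choose e'))" for j
      unfolding s_def sign[of j] by (simp only: mult_ac)
    then have "(\<Sum>j<N. s j * int (e choose j)) =
        (-1) ^ (e + e') * (\<Sum>j<N. (-1) ^ (e + j) * int (e choose j) * int (j choose e'))"
      by (simp only: sum_distrib_left)
    then show ?thesis using alternating_choose_choose[OF that] by auto
  qed
  have "Binom j' (Proj e' v) = (\<Sum>j''<N. scale (of_int (s j'')) (Binom j' (Binom j'' v)))"
    by (simp only: Proj_def Binom_sum Binom_of_int s_def)
  also have "\<dots> = (\<Sum>j''<N. \<Sum>e<N. scale (of_int (int (e choose j') * (s j'' * int (e choose j'')))) (Proj e v))"
  proof (intro sum.cong refl)
    fix j'' assume "j'' \<in> {..<N}"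
    then have "Binom j' (Binom j'' v) =
        (\<Sum>j<N. scale (of_int (int (choose_product_coeff j' j'' j))) (Binom j v))"
      using assms by (simp only: Binom_Binom lessThan_iff)
    also have "\<dots> = (\<Sum>j<N. scale (of_int (int (choose_product_coeff j' j'' j)))
        (\<Sum>e<N. scale (of_int (int (e choose j))) (Proj e v)))"
      by (intro sum.cong refl) (simp only: Binom_eq_sum_Proj[symmetric] lessThan_iff)
    \<comment> \<open>After the exchange of sums, the coefficient of \<open>Proj e\<close> is the
      value at \<open>e\<close> of the product of two binomial functions.\<close>
    also have "\<dots> = (\<Sum>e<N. scale (of_int (int (\<Sum>j<N. choose_product_coeff j' j'' j * (e choose j)))) (Proj e v))"
      unfolding scale_sum_right scale_scale of_nat_sum of_int_sum scale_sum_left of_nat_mult of_int_mult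
      by (rule sum.swap)
    also have "\<dots> = (\<Sum>e<N. scale (of_int (int (e choose j') * int (e choose j''))) (Proj e v))"
      by (intro sum.cong refl) (simp only: choose_times_choose[symmetric] lessThan_iff of_nat_mult)
    finally have "scale (of_int (s j'')) (Binom j' (Binom j'' v)) =
        (\<Sum>e<N. scale (of_int (s j'' * (int (e choose j') * int (e choose j'')))) (Proj e v))"
      by (simp only: scale_sum_right scale_scale of_int_mult)
    also have "\<dots> = (\<Sum>e<N. scale (of_int (int (e choose j') * (s j'' * int (e choose j'')))) (Proj e v))"
      by (simp only: mult.left_commute)
    finally show "scale (of_int (s j'')) (Binom j' (Binom j'' v)) =
        (\<Sum>e<N. scale (of_int (int (e choose j') * (s j'' * int (e choose j'')))) (Proj e v))" .
  qed
  also have "\<dots> = (\<Sum>e<N. scale (of_int (int (e choose j') * (\<Sum>j''<N. s j'' * int (e choose j'')))) (Proj e v))"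
    unfolding sum_distrib_left of_int_sum scale_sum_left by (rule sum.swap)
  also have "\<dots> = (\<Sum>e<N. scale (of_int (int (e choose j') * (if e = e' then 1 else 0))) (Proj e v))"
    by (intro sum.cong refl) (simp only: inversion lessThan_iff)
  also have "\<dots> = (\<Sum>e<N. if e = e' then scale (of_int (int (e' choose j'))) (Proj e' v) else 0)"
    by (intro sum.cong refl) auto
  also have "\<dots> = scale (of_int (int (e' choose j'))) (Proj e' v)"
    using assms by simp
  finally show ?thesis .
qed

text \<open>The eigenvalues are those of the operators on the e-th power of the coordinate, so
  \<open>e\<close> is a degree.\<close>

definition homogeneous :: "nat \<Rightarrow> 'f \<Rightarrow> bool" where
  "homogeneous e v \<longleftrightarrow> (\<forall>j. D j v = scale (power_op_coeff p m j (int e)) v)"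

lemma homogeneous_Proj:
  assumes "e < N"
  shows "homogeneous e (Proj e v)"
  unfolding homogeneous_def
proof
  fix j
  show "D j (Proj e v) = scale (power_op_coeff p m j (int e)) (Proj e v)"
  proof (cases "j < N")
    case True
    then show ?thesis using assms
      by (simp add: D_eq_Binom Binom_Proj power_op_coeff_nat)
  next
    case False
    then show ?thesis by (simp add: D_eq_0 power_op_coeff_eq_0)
  qed
qed

text \<open>Invariant of the induction: the first \<open>k\<close> vectors are homogeneous. The next
  step exchanges only \<open>w k\<close>, for one of its components.\<close>

lemma homogeneous_frame:
  assumes local: "\<And>x y :: 'o. x + y dvd 1 \<Longrightarrow> x dvd 1 \<or> y dvd 1"
    and "free_of_rank n scale"
  obtains w e where "is_frame n w" "\<And>i. i < n \<Longrightarrow> e i < N \<and> homogeneous (e i) (w i)"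
proof -
  have "k \<le> n \<Longrightarrow> \<exists>w e. is_frame n w \<and> (\<forall>i<k. e i < N \<and> homogeneous (e i) (w i))" for k
  proof (induction k)
    case 0
    show ?case using free_of_rank_frame[OF assms(2)] by auto
  next
    case (Suc k)
    then obtain w e where w: "is_frame n w" and e: "\<forall>i<k. e i < N \<and> homogeneous (e i) (w i)"
      by auto
    have "\<forall>d. \<exists>c. Proj d (w k) = frame_comb n w c" using w unfolding is_frame_def by blast
    then obtain c where c: "\<And>d. Proj d (w k) = frame_comb n w (c d)" by metis
    have "frame_comb n w (\<lambda>i. \<Sum>d<N. c d i) = frame_comb n w (\<lambda>i. if i = k then 1 else 0)"
      using Suc.prems by (simp add: frame_comb_sum frame_comb_unit sum_Proj flip: c)
    \<comment> \<open>The components \<open>Proj d (w k)\<close> add up to \<open>w k\<close>, whose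
      \<open>k\<close>-th coordinate is 1; by locality one summand is a unit.\<close>
    then have "(\<Sum>d<N. c d k) = 1"
      using frame_comb_inj[OF w, of "\<lambda>i. \<Sum>d<N. c d i" _ k] Suc.prems by simp
    then obtain d where d: "d < N" "c d k dvd 1"
      using sum_unit_local[of "{..<N}" "\<lambda>d. c d k"] local by auto
    then obtain u where "u * c d k = 1" by (metis dvdE mult.commute)
    then have "is_frame n (w(k := Proj d (w k)))"
      using is_frame_exchange[OF w _ c] Suc.prems by simp
    moreover have "\<forall>i<Suc k. (e(k := d)) i < N \<and> homogeneous ((e(k := d)) i) ((w(k := Proj d (w k))) i)"
      using e d homogeneous_Proj by (auto simp: less_Suc_eq)
    ultimately show ?case by blast
  qed
  from this[of n] show ?thesis using that by auto
qed

end

section \<open>Local rings\<close>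

text \<open>Replaces ideals of the ring record by closure conditions on a set; additive inverses
  come from multiplication by -1.\<close>

lemma ideal_ring_of_type_algebra_iff:
  fixes I :: "'a::comm_ring_1 set"
  shows "ideal I (ring_of_type_algebra :: 'a ring) \<longleftrightarrow>
    0 \<in> I \<and> (\<forall>a\<in>I. \<forall>b\<in>I. a + b \<in> I) \<and> (\<forall>a\<in>I. \<forall>r. r * a \<in> I)"
proof
  let ?R = "ring_of_type_algebra :: 'a ring"
  assume "ideal I ?R"
  then interpret ideal I ?R .
  show "0 \<in> I \<and> (\<forall>a\<in>I. \<forall>b\<in>I. a + b \<in> I) \<and> (\<forall>a\<in>I. \<forall>r. r * a \<in> I)"
    using additive_subgroup.zero_closed[OF is_additive_subgroup]
      additive_subgroup.a_closed[OF is_additive_subgroup] I_l_closed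
    by (simp add: ring_of_type_algebra_def)
next
  let ?R = "ring_of_type_algebra :: 'a ring"
  assume I: "0 \<in> I \<and> (\<forall>a\<in>I. \<forall>b\<in>I. a + b \<in> I) \<and> (\<forall>a\<in>I. \<forall>r. r * a \<in> I)"
  interpret cring ?R by (rule cring_from_type_algebra)
  show "ideal I ?R"
  proof (rule idealI)
    show "subgroup I (add_monoid ?R)"
    proof
      fix a assume a: "a \<in> I"
      have "\<ominus>\<^bsub>?R\<^esub> a = - a"
        by (rule minus_equality) (auto simp: ring_of_type_algebra_def)
      moreover have "- 1 * a \<in> I" using I a by blast
      ultimately show "inv\<^bsub>add_monoid ?R\<^esub> a \<in> I" by (simp add: a_inv_def)
    qed (use I in \<open>auto simp: ring_of_type_algebra_def\<close>)
  next
    show "ring ?R" by (rule ring_axioms)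
  qed (use I in \<open>auto simp: ring_of_type_algebra_def mult.commute\<close>)
qed

text \<open>Zorn's lemma for the ideals that contain \<open>x\<close> but not 1. The multiples of
  \<open>x\<close> form such an ideal, and anything strictly above a maximal one contains 1.\<close>

lemma nonunit_in_maximalideal:
  fixes x :: "'a::comm_ring_1"
  assumes "\<not> x dvd 1"
  obtains M where "maximalideal M (ring_of_type_algebra :: 'a ring)" "x \<in> M"
proof -
  let ?R = "ring_of_type_algebra :: 'a ring"
  define A where "A = {I. ideal I ?R \<and> x \<in> I \<and> 1 \<notin> I}"
  have "range (\<lambda>r. r * x) \<in> A"
    unfolding A_def ideal_ring_of_type_algebra_iff
  proof (intro CollectI conjI ballI allI)
    show "1 \<notin> range (\<lambda>r. r * x)" using assms by (metis dvd_triv_right imageE)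
    show "x \<in> range (\<lambda>r. r * x)" by (metis mult_1 rangeI)
    show "0 \<in> range (\<lambda>r. r * x)" by (metis mult_zero_left rangeI)
  next
    fix a b assume "a \<in> range (\<lambda>r. r * x)" "b \<in> range (\<lambda>r. r * x)"
    then show "a + b \<in> range (\<lambda>r. r * x)" by (auto simp flip: distrib_right)
  next
    fix a r assume "a \<in> range (\<lambda>r. r * x)"
    then show "r * a \<in> range (\<lambda>r. r * x)" by (auto simp flip: mult.assoc)
  qed
  moreover have "\<Union>C \<in> A" if "C \<noteq> {}" "subset.chain A C" for C
  proof -
    have C: "\<And>I. I \<in> C \<Longrightarrow> I \<in> A" and chain: "\<And>I J. I \<in> C \<Longrightarrow> J \<in> C \<Longrightarrow> I \<subseteq> J \<or> J \<subseteq> I"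
      using that(2) by (auto simp: subset.chain_def)
    have "a + b \<in> \<Union>C" if ab: "a \<in> \<Union>C" "b \<in> \<Union>C" for a b
    proof -
      obtain I J where "I \<in> C" "a \<in> I" "J \<in> C" "b \<in> J" using ab by blast
      then obtain L where "L \<in> C" "a \<in> L" "b \<in> L" using chain by blast
      then show ?thesis using C unfolding A_def ideal_ring_of_type_algebra_iff by blast
    qed
    then show ?thesis
      using C that(1) unfolding A_def ideal_ring_of_type_algebra_iff by blast
  qed
  ultimately obtain M where M: "M \<in> A" "\<And>J. J \<in> A \<Longrightarrow> M \<subseteq> J \<Longrightarrow> J = M"
    using subset_Zorn_nonempty[of A] by blast
  have "maximalideal M ?R"
  proof (rule maximalidealI)
    show "ideal M ?R" using M(1) by (simp add: A_def)
    show "carrier ?R \<noteq> M" using M(1) by (auto simp: A_def ring_of_type_algebra_def)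
  next
    fix J assume J: "ideal J ?R" "M \<subseteq> J"
    show "J = M \<or> J = carrier ?R"
    proof (cases "1 \<in> J")
      case True
      then have "r * 1 \<in> J" for r using J(1) unfolding ideal_ring_of_type_algebra_iff by blast
      then show ?thesis by (auto simp: ring_of_type_algebra_def)
    next
      case False
      then have "J \<in> A" using J M(1) by (auto simp: A_def)
      then show ?thesis using M(2) J(2) by blast
    qed
  qed
  then show ?thesis using that M(1) by (auto simp: A_def)
qed

text \<open>Two nonunits would both lie in \<open>M\<close>, and so would their sum, a unit; but
  \<open>M\<close> is proper.\<close>

lemma unit_sum_if_unique_maximalideal:
  fixes x y :: "'a::comm_ring_1"
  assumes "\<And>I. maximalideal I (ring_of_type_algebra :: 'a ring) \<Longrightarrow> I = M"
    and "x + y dvd 1"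
  shows "x dvd 1 \<or> y dvd 1"
proof (rule ccontr)
  let ?R = "ring_of_type_algebra :: 'a ring"
  assume *: "\<not> (x dvd 1 \<or> y dvd 1)"
  then obtain I J where I: "maximalideal I ?R" "x \<in> I" and J: "maximalideal J ?R" "y \<in> J"
    using nonunit_in_maximalideal by metis
  then have max: "maximalideal M ?R" and "x \<in> M" "y \<in> M" using assms(1) by auto
  then have M: "ideal M ?R" using maximalideal.axioms(1) by blast
  obtain u where "(x + y) * u = 1" using assms(2) by (metis dvdE)
  moreover have "u * (x + y) \<in> M"
    using M \<open>x \<in> M\<close> \<open>y \<in> M\<close> unfolding ideal_ring_of_type_algebra_iff by blast
  ultimately have "1 \<in> M" by (simp add: mult.commute)
  then have "r * 1 \<in> M" for r using M unfolding ideal_ring_of_type_algebra_iff by blast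
  then have "M = carrier ?R" by (auto simp: ring_of_type_algebra_def)
  then show False using maximalideal.I_notcarr[OF max] by simp
qed

section \<open>Isomorphisms of modules over the ring of differential operators\<close>

lemma diff_op_iso_comp:
  assumes "diff_op_iso A sA DA B sB DB \<phi>" "diff_op_iso B sB DB C sC DC \<psi>"
  shows "diff_op_iso A sA DA C sC DC (\<psi> \<circ> \<phi>)"
proof -
  have "\<phi> v \<in> B" if "v \<in> A" for v
    using that assms(1) by (auto simp: diff_op_iso_def linear_iso_def bij_betw_def)
  then show ?thesis
    using assms unfolding diff_op_iso_def linear_iso_def by (auto intro: bij_betw_trans)
qed

lemma diff_op_iso_inv:
  assumes iso: "diff_op_iso A sA DA B sB DB \<phi>"
    and add: "\<And>u v. u \<in> A \<Longrightarrow> v \<in> A \<Longrightarrow> u + v \<in> A"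
    and scale: "\<And>r v. v \<in> A \<Longrightarrow> sA r v \<in> A"
    and ops: "\<And>j v. v \<in> A \<Longrightarrow> DA j v \<in> A"
  shows "diff_op_iso B sB DB A sA DA (inv_into A \<phi>)"
proof -
  have bij: "bij_betw \<phi> A B" using iso by (simp add: diff_op_iso_def linear_iso_def)
  have inv: "inv_into A \<phi> (\<phi> v) = v" if "v \<in> A" for v
    using bij that by (rule bij_betw_inv_into_left)
  have obt: "\<exists>v\<in>A. x = \<phi> v" if "x \<in> B" for x
    using bij that by (auto simp: bij_betw_def)
  show ?thesis
    unfolding diff_op_iso_def linear_iso_def
  proof (intro conjI ballI allI bij_betw_inv_into[OF bij])
    fix x y assume "x \<in> B" "y \<in> B"
    then obtain u v where "u \<in> A" "v \<in> A" "x = \<phi> u" "y = \<phi> v" using obt by meson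
    moreover from this have "x + y = \<phi> (u + v)"
      using iso by (simp add: diff_op_iso_def linear_iso_def)
    ultimately show "inv_into A \<phi> (x + y) = inv_into A \<phi> x + inv_into A \<phi> y"
      by (simp add: add inv)
  next
    fix r y assume "y \<in> B"
    then obtain v where "v \<in> A" "y = \<phi> v" using obt by meson
    moreover from this have "sB r y = \<phi> (sA r v)"
      using iso by (simp add: diff_op_iso_def linear_iso_def)
    ultimately show "inv_into A \<phi> (sB r y) = sA r (inv_into A \<phi> y)"
      by (simp add: scale inv)
  next
    fix j y assume "y \<in> B"
    then obtain v where "v \<in> A" "y = \<phi> v" using obt by meson
    moreover from this have "DB j y = \<phi> (DA j v)"
      using iso by (simp add: diff_op_iso_def)
    ultimately show "inv_into A \<phi> (DB j y) = DA j (inv_into A \<phi> y)"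
      by (simp add: ops inv)
  qed
qed

text \<open>The matrix form of a linear map, obtained by building up \<open>v\<close> one coordinate
  at a time.\<close>

lemma linear_iso_dsum_expand:
  fixes \<psi> :: "(nat \<Rightarrow> 'o::comm_ring_1) \<Rightarrow> (nat \<Rightarrow> 'o)"
  assumes "linear_iso (dsum_carrier n) dsum_scale (dsum_carrier n) dsum_scale \<psi>"
    and "v \<in> dsum_carrier n"
  shows "\<psi> v i = (\<Sum>j<n. v j * \<psi> (\<lambda>i. if i = j then 1 else 0) i)"
proof -
  have add: "\<psi> (u + u') = \<psi> u + \<psi> u'" if "u \<in> dsum_carrier n" "u' \<in> dsum_carrier n" for u u'
    using assms(1) that by (simp add: linear_iso_def)
  have scale: "\<psi> (dsum_scale r u) = dsum_scale r (\<psi> u)" if "u \<in> dsum_carrier n" for r u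
    using assms(1) that by (simp add: linear_iso_def)
  have "k \<le> n \<Longrightarrow> \<psi> (\<lambda>i. if i < k then v i else 0) i =
      (\<Sum>j<k. v j * \<psi> (\<lambda>i. if i = j then 1 else 0) i)" for k
  proof (induction k)
    case 0
    have "\<psi> (0 + 0) = \<psi> 0 + \<psi> 0" by (rule add) (auto simp: dsum_carrier_def)
    then have "\<psi> 0 = 0" by simp
    then show ?case by (simp add: zero_fun_def)
  next
    case (Suc k)
    let ?e = "\<lambda>i. if i = k then 1 else 0 :: 'o"
    have split: "(\<lambda>i. if i < Suc k then v i else 0) = (\<lambda>i. if i < k then v i else 0) + dsum_scale (v k) ?e"
      by (auto simp: dsum_scale_def less_Suc_eq)
    have "\<psi> (\<lambda>i. if i < Suc k then v i else 0) =
        \<psi> (\<lambda>i. if i < k then v i else 0) + \<psi> (dsum_scale (v k) ?e)"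
      unfolding split using Suc.prems by (intro add) (auto simp: dsum_carrier_def dsum_scale_def)
    also have "\<psi> (dsum_scale (v k) ?e) = dsum_scale (v k) (\<psi> ?e)"
      using Suc.prems by (intro scale) (auto simp: dsum_carrier_def)
    finally show ?case using Suc by (simp add: dsum_scale_def)
  qed
  from this[of n] have "\<psi> (\<lambda>i. if i < n then v i else 0) i = (\<Sum>j<n. v j * \<psi> (\<lambda>i. if i = j then 1 else 0) i)"
    by simp
  moreover have "(\<lambda>i. if i < n then v i else 0) = v"
    using assms(2) by (auto simp: dsum_carrier_def)
  ultimately show ?thesis by simp
qed

text \<open>A right inverse makes the determinant a unit, hence nonzero. So some term of its Leibniz
  expansion is nonzero, and with it every factor.\<close>

lemma right_inverse_imp_permutation:
  fixes a b :: "nat \<Rightarrow> nat \<Rightarrow> 'a::comm_ring_1"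
  assumes "\<And>i k. i < n \<Longrightarrow> k < n \<Longrightarrow> (\<Sum>j<n. a i j * b j k) = (if i = k then 1 else 0)"
  obtains \<sigma> where "\<sigma> permutes {..<n}" "\<And>i. i < n \<Longrightarrow> a i (\<sigma> i) \<noteq> 0"
proof -
  define A where "A = mat n n (\<lambda>(i, j). a i j)"
  define B where "B = mat n n (\<lambda>(i, j). b i j)"
  have A: "A \<in> carrier_mat n n" and B: "B \<in> carrier_mat n n" by (auto simp: A_def B_def)
  have "A * B = 1\<^sub>m n"
    by (rule eq_matI) (auto simp: A_def B_def scalar_prod_def assms atLeast0LessThan)
  then have "det A * det B = 1" using det_mult[OF A B] by simp
  then have "det A \<noteq> 0" by auto
  then have "(\<Sum>\<sigma> | \<sigma> permutes {0..<n}. signof \<sigma> * (\<Prod>i = 0..<n. A $$ (i, \<sigma> i))) \<noteq> 0"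
    using det_def'[OF A] by simp
  then obtain \<sigma> where \<sigma>: "\<sigma> permutes {0..<n}" "(\<Prod>i = 0..<n. A $$ (i, \<sigma> i)) \<noteq> 0"
    by (metis (mono_tags, lifting) mem_Collect_eq mult_zero_right sum.not_neutral_contains_not_neutral)
  have "a i (\<sigma> i) \<noteq> 0" if "i < n" for i
  proof
    assume "a i (\<sigma> i) = 0"
    then have "A $$ (i, \<sigma> i) = 0"
      using that permutes_in_image[OF \<sigma>(1), of i] by (simp add: A_def)
    then have "(\<Prod>i = 0..<n. A $$ (i, \<sigma> i)) = 0" using that by (intro prod_zero) auto
    then show False using \<sigma>(2) by simp
  qed
  then show ?thesis using that \<sigma>(1) by (simp add: atLeast0LessThan)
qed

section \<open>Rings with a logarithmic structure at the origin\<close>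

text \<open>The common interface of both local models: \<open>ev\<close> is evaluation at the
  origin, with section \<open>c\<close> and kernel generated by \<open>G\<close>.
  \<open>ev_unit\<close> lifts locality from the base ring; \<open>E_shift\<close> is the Leibniz
  rule for \<open>x\<close> times a generator of degree \<open>- d\<close>.\<close>

locale log_ring = char_prime_level p m "TYPE('o)"
  for p m :: nat and E :: "int \<Rightarrow> nat \<Rightarrow> 'o::comm_ring_1 \<Rightarrow> 'o"
    and ev :: "'o \<Rightarrow> 'a::comm_ring_1" and c :: "'a \<Rightarrow> 'o" and G :: "'o set" +
  assumes CHAR_residue: "CHAR('a) = p"
    and ev_add: "ev (x + y) = ev x + ev y"
    and ev_mult: "ev (x * y) = ev x * ev y"
    and ev_1: "ev 1 = 1"
    and ev_c: "ev (c r) = r"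
    and ev_unit: "ev x dvd 1 \<Longrightarrow> x dvd 1"
    and ev_G: "g \<in> G \<Longrightarrow> ev g = 0"
    and ev_eq_0: "ev x = 0 \<Longrightarrow> \<exists>k. x = (\<Sum>g\<in>G. g * k g)"
    and ev_E: "ev (E d j x) = power_op_coeff p m j (- d) * ev x"
    and E_add: "E d j (x + y) = E d j x + E d j y"
    and E_shift: "E d j x = (\<Sum>i\<le>j. zp_reduce p (leibniz_coeff p m i (j - i)) * E 0 i x *
      power_op_coeff p m (j - i) (- d))"
begin

lemma ev_0: "ev 0 = 0"
  using ev_add[of 0 0] by simp

lemma ev_diff: "ev (x - y) = ev x - ev y"
  using ev_add[of "x - y" y] by simp

lemma ev_sum: "ev (sum f A) = (\<Sum>i\<in>A. ev (f i))"
  by (induction A rule: infinite_finite_induct) (auto simp: ev_0 ev_add)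

lemma E_0: "E d j 0 = 0"
  using E_add[of d j 0 0] by simp

lemma dsum_iso_mset_eq:
  assumes iso: "diff_op_iso (dsum_carrier n) dsum_scale (dsum_op E ds)
      (dsum_carrier n) dsum_scale (dsum_op E ds') \<psi>"
    and n: "length ds = n" "length ds' = n"
    and residues: "set ds \<subseteq> residues_mod p m" "set ds' \<subseteq> residues_mod p m"
  shows "mset ds = mset ds'"
proof -
  interpret residue: char_prime_level p m "TYPE('a)" by unfold_locales (rule CHAR_residue)
  define e where "e j = (\<lambda>i. if i = j then 1 else 0 :: 'o)" for j :: nat
  have e: "e j \<in> dsum_carrier n" if "j < n" for j using that by (auto simp: e_def dsum_carrier_def)
  have lin: "linear_iso (dsum_carrier n) dsum_scale (dsum_carrier n) dsum_scale \<psi>"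
    using iso by (simp add: diff_op_iso_def)
  then have bij: "bij_betw \<psi> (dsum_carrier n) (dsum_carrier n)" by (simp add: linear_iso_def)
  define \<chi> where "\<chi> = inv_into (dsum_carrier n) \<psi>"
  have \<chi>: "\<chi> u \<in> dsum_carrier n" "\<psi> (\<chi> u) = u" if "u \<in> dsum_carrier n" for u
    using bij that by (auto simp: \<chi>_def bij_betw_inv_into_right intro: inv_into_into simp: bij_betw_def)
  \<comment> \<open>The matrices of the isomorphism and of its inverse at the origin, with the row
    index first.\<close>
  define a where "a i j = ev (\<psi> (e j) i)" for i j
  define b where "b j k = ev (\<chi> (e k) j)" for j k
  have "(\<Sum>j<n. a i j * b j k) = (if i = k then 1 else 0)" if "i < n" "k < n" for i k
  proof -
    have "(\<Sum>j<n. a i j * b j k) = ev (\<Sum>j<n. \<chi> (e k) j * \<psi> (e j) i)"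
      by (simp add: a_def b_def ev_sum ev_mult mult.commute)
    also have "(\<Sum>j<n. \<chi> (e k) j * \<psi> (e j) i) = \<psi> (\<chi> (e k)) i"
      unfolding e_def[abs_def] by (subst linear_iso_dsum_expand[OF lin]) (use \<chi> e that e_def in auto)
    also have "\<dots> = e k i" using \<chi>(2)[OF e[OF that(2)]] by simp
    finally show ?thesis by (simp add: e_def ev_0 ev_1)
  qed
  then obtain \<sigma> where \<sigma>: "\<sigma> permutes {..<n}" "\<And>i. i < n \<Longrightarrow> a i (\<sigma> i) \<noteq> 0"
    using right_inverse_imp_permutation by blast
  \<comment> \<open>Commuting with the operators makes a nonzero entry see the same eigenvalues in
    summand \<open>j\<close> of the source and summand \<open>i\<close> of the target.\<close>
  have eq: "ds ! j = ds' ! i" if "i < n" "j < n" "a i j \<noteq> 0" for i j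
  proof (rule residue.power_op_coeff_separates)
    show "ds ! j \<in> residues_mod p m" "ds' ! i \<in> residues_mod p m"
      using residues n that by (auto dest: nth_mem)
    show "a i j \<noteq> 0" by (rule that)
    fix l
    \<comment> \<open>The factor \<open>E (ds ! j) l 1\<close> is an element of the ring; its value
      under \<open>ev\<close> is the eigenvalue.\<close>
    have "dsum_op E ds l (e j) = dsum_scale (E (ds ! j) l 1) (e j)"
      using that n by (auto simp: dsum_op_def dsum_scale_def e_def E_0)
    then have "dsum_scale (E (ds ! j) l 1) (\<psi> (e j)) = dsum_op E ds' l (\<psi> (e j))"
      using iso e[OF \<open>j < n\<close>] by (metis diff_op_iso_def linear_iso_def)
    then have "E (ds ! j) l 1 * \<psi> (e j) i = E (ds' ! i) l (\<psi> (e j) i)"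
      using that n by (simp add: dsum_scale_def dsum_op_def fun_eq_iff)
    then show "power_op_coeff p m l (- (ds ! j)) * a i j = power_op_coeff p m l (- (ds' ! i)) * a i j"
      unfolding a_def by (metis ev_E ev_mult ev_1 mult_1_right)
  qed
  have "permute_list \<sigma> ds = ds'"
  proof (rule nth_equalityI)
    fix i assume "i < length (permute_list \<sigma> ds)"
    then have "i < n" using n by simp
    moreover have "\<sigma> i < n" using permutes_in_image[OF \<sigma>(1), of i] \<open>i < n\<close> by simp
    ultimately show "permute_list \<sigma> ds ! i = ds' ! i"
      using eq \<sigma> n by (simp add: permute_list_nth)
  qed (simp add: n)
  then show ?thesis using mset_permute_list[of \<sigma> ds] \<sigma>(1) n by metis
qed

lemma exponents_unique:
  assumes iso: "isomorphic scale D scale' D'"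
    and ds: "length ds = n" "set ds \<subseteq> residues_mod p m" "iso_from_dsum E ds scale D"
    and ds': "length ds' = n" "set ds' \<subseteq> residues_mod p m" "iso_from_dsum E ds' scale' D'"
  shows "mset ds = mset ds'"
proof -
  obtain \<chi> where \<chi>: "diff_op_iso UNIV scale D UNIV scale' D' \<chi>"
    using iso unfolding isomorphic_def by blast
  obtain \<phi> where \<phi>: "diff_op_iso (dsum_carrier n) dsum_scale (dsum_op E ds) UNIV scale D \<phi>"
    using ds(1,3) unfolding iso_from_dsum_def by blast
  obtain \<phi>' where \<phi>': "diff_op_iso (dsum_carrier n) dsum_scale (dsum_op E ds') UNIV scale' D' \<phi>'"
    using ds'(1,3) unfolding iso_from_dsum_def by blast
  have "diff_op_iso UNIV scale' D' (dsum_carrier n) dsum_scale (dsum_op E ds')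
      (inv_into (dsum_carrier n) \<phi>')"
    using \<phi>' by (rule diff_op_iso_inv) (use ds'(1) in \<open>auto simp: dsum_carrier_def dsum_scale_def dsum_op_def\<close>)
  with diff_op_iso_comp[OF \<phi> \<chi>] show ?thesis
    using dsum_iso_mset_eq[OF diff_op_iso_comp] ds ds' by blast
qed

end

section \<open>Cosets of the origin submodule\<close>

context framed_module
begin

lemma coset_eq_iff:
  assumes "subspace K"
  shows "x +o K = y +o K \<longleftrightarrow> x - y \<in> K"
proof
  assume "x +o K = y +o K"
  moreover have "x \<in> x +o K" using subspace_0[OF assms] by (force simp: elt_set_plus_def)
  ultimately obtain k where "k \<in> K" "x = y + k" by (auto simp: elt_set_plus_def)
  then show "x - y \<in> K" by simp
next
  have sub: "x +o K \<subseteq> y +o K" if "x - y \<in> K" for x y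
  proof
    fix z assume "z \<in> x +o K"
    then obtain k where "k \<in> K" "z = x + k" by (auto simp: elt_set_plus_def)
    then have "z = y + ((x - y) + k)" "(x - y) + k \<in> K" using subspace_add[OF assms that] by auto
    then show "z \<in> y +o K" unfolding elt_set_plus_def by blast
  qed
  assume "x - y \<in> K"
  then show "x +o K = y +o K" using sub subspace_neg[OF assms, of "x - y"] by (intro equalityI) auto
qed

lemma coset_add:
  assumes "subspace K"
  shows "(x +o K) + (y +o K) = (x + y) +o K"
proof (intro equalityI subsetI)
  fix z assume "z \<in> (x +o K) + (y +o K)"
  then obtain k l where "k \<in> K" "l \<in> K" "z = (x + k) + (y + l)"
    by (auto simp: set_plus_def elt_set_plus_def)
  then have "z = (x + y) + (k + l)" "k + l \<in> K" using subspace_add[OF assms] by auto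
  then show "z \<in> (x + y) +o K" by (auto simp: elt_set_plus_def)
next
  fix z assume "z \<in> (x + y) +o K"
  then obtain k where k: "k \<in> K" "z = (x + k) + (y + 0)" by (auto simp: elt_set_plus_def)
  have "x + k \<in> x +o K" "y + 0 \<in> y +o K"
    using k(1) subspace_0[OF assms] unfolding elt_set_plus_def by blast+
  then show "z \<in> (x +o K) + (y +o K)" unfolding k(2) by (rule set_plus_intro)
qed

text \<open>As \<open>f\<close> preserves \<open>K\<close>, it sends a coset into a single coset,
  and adding \<open>K\<close> fills that one. So \<open>fibre_map\<close> is the induced
  map.\<close>

lemma coset_image:
  assumes "subspace K" "\<And>x y. f (x + y) = f x + f y" "\<And>k. k \<in> K \<Longrightarrow> f k \<in> K"
  shows "f ` (x +o K) + K = f x +o K"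
proof (intro equalityI subsetI)
  fix z assume "z \<in> f ` (x +o K) + K"
  then obtain k l where "k \<in> K" "l \<in> K" "z = f (x + k) + l"
    by (auto simp: set_plus_def elt_set_plus_def)
  then have "z = f x + (f k + l)" "f k + l \<in> K" using subspace_add[OF assms(1) assms(3)] assms(2) by auto
  then show "z \<in> f x +o K" by (auto simp: elt_set_plus_def)
next
  fix z assume "z \<in> f x +o K"
  then obtain k where k: "k \<in> K" "z = f x + k" by (auto simp: elt_set_plus_def)
  have "x + 0 \<in> x +o K" using subspace_0[OF assms(1)] unfolding elt_set_plus_def by blast
  then have "f x \<in> f ` (x +o K)" by (metis add_0_right imageI)
  then show "z \<in> f ` (x +o K) + K" unfolding k(2) using k(1) by (rule set_plus_intro)
qed

end

section \<open>Frames of eigenvectors\<close>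

locale log_frame = log_ring p m E ev c G + diff_op_module p m "E 0" scale D + framed_module scale
  for p m :: nat and E :: "int \<Rightarrow> nat \<Rightarrow> 'o::comm_ring_1 \<Rightarrow> 'o"
    and ev :: "'o \<Rightarrow> 'a::comm_ring_1" and c :: "'a \<Rightarrow> 'o" and G :: "'o set"
    and scale :: "'o \<Rightarrow> 'f::ab_group_add \<Rightarrow> 'f" and D +
  fixes w :: "nat \<Rightarrow> 'f" and ds :: "int list"
  assumes frame: "is_frame (length ds) w"
    and residues: "set ds \<subseteq> residues_mod p m"
    and D_w: "i < length ds \<Longrightarrow> D j (w i) = scale (power_op_coeff p m j (- (ds ! i))) (w i)"
begin

abbreviation comb :: "(nat \<Rightarrow> 'o) \<Rightarrow> 'f" where "comb \<equiv> frame_comb (length ds) w"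

abbreviation K :: "'f set" where "K \<equiv> origin_submodule scale G"

text \<open>On multiples of \<open>w i\<close> the Leibniz rule is the right hand side of
  \<open>E_shift\<close> with exponent \<open>ds ! i\<close>.\<close>

lemma D_comb: "D j (comb v) = comb (\<lambda>i. E (ds ! i) j (v i))"
proof -
  have "D j (scale (v i) (w i)) = scale (E (ds ! i) j (v i)) (w i)" if "i < length ds" for i
  proof -
    have "D j (scale (v i) (w i)) = scale (\<Sum>k\<le>j. zp_reduce p (leibniz_coeff p m k (j - k)) *
        E 0 k (v i) * power_op_coeff p m (j - k) (- (ds ! i))) (w i)"
      using that by (simp add: D_leibniz D_w scale_sum_left)
    then show ?thesis by (simp only: E_shift[symmetric])
  qed
  then show ?thesis by (simp add: frame_comb_def D_sum)
qed

lemma iso_from_dsum: "iso_from_dsum E ds scale D"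
  unfolding iso_from_dsum_def diff_op_iso_def linear_iso_def
proof (intro exI[of _ comb] conjI ballI allI frame_bij_betw[OF frame])
  show "comb (u + v) = comb u + comb v" for u v
    by (simp add: plus_fun_def frame_comb_add)
  show "comb (dsum_scale r v) = scale r (comb v)" for r v
    by (simp add: dsum_scale_def frame_comb_scale)
  show "comb (dsum_op E ds j v) = D j (comb v)" for j v
    unfolding D_comb by (intro frame_comb_cong) (simp add: dsum_op_def)
qed

lemma subspace_K: "subspace K"
  unfolding origin_submodule_def by (rule subspace_span)

lemma obtain_coordinates: obtains v where "x = comb v"
  using frame unfolding is_frame_def by blast

text \<open>The vectors with coordinates in the kernel of \<open>ev\<close> form a submodule
  containing the generators of \<open>K\<close>; conversely, \<open>ev_eq_0\<close> writes each such
  coordinate as a combination of elements of \<open>G\<close>.\<close>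

lemma comb_in_K_iff: "comb v \<in> K \<longleftrightarrow> (\<forall>i<length ds. ev (v i) = 0)"
proof
  define S where "S = {comb u |u. \<forall>i<length ds. ev (u i) = 0}"
  have "K \<subseteq> S"
    unfolding origin_submodule_def
  proof (rule span_minimal)
    show "{scale g x |g x. g \<in> G} \<subseteq> S"
    proof
      fix y assume "y \<in> {scale g x |g x. g \<in> G}"
      then obtain g x where g: "g \<in> G" "y = scale g x" by blast
      obtain u where "x = comb u" by (rule obtain_coordinates)
      then have "y = comb (\<lambda>i. g * u i)" using g(2) by (simp add: frame_comb_scale)
      moreover have "ev (g * u i) = 0" for i using ev_G[OF g(1)] by (simp add: ev_mult)
      ultimately show "y \<in> S" unfolding S_def by blast
    qed
    show "subspace S"
    proof (rule subspaceI)
      show "0 \<in> S"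
        unfolding S_def by (intro CollectI exI[of _ "\<lambda>_. 0"]) (simp add: frame_comb_def ev_0)
    next
      fix x y assume "x \<in> S" "y \<in> S"
      then obtain u v where "x = comb u" "y = comb v"
        "\<forall>i<length ds. ev (u i) = 0" "\<forall>i<length ds. ev (v i) = 0" unfolding S_def by blast
      then have "x + y = comb (\<lambda>i. u i + v i)" "\<forall>i<length ds. ev (u i + v i) = 0"
        by (auto simp: frame_comb_add ev_add)
      then show "x + y \<in> S" unfolding S_def by blast
    next
      fix r x assume "x \<in> S"
      then obtain u where "x = comb u" "\<forall>i<length ds. ev (u i) = 0" unfolding S_def by blast
      then have "scale r x = comb (\<lambda>i. r * u i)" "\<forall>i<length ds. ev (r * u i) = 0"
        by (auto simp: frame_comb_scale ev_mult)
      then show "scale r x \<in> S" unfolding S_def by blast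
    qed
  qed
  moreover assume "comb v \<in> K"
  ultimately obtain u where u: "comb v = comb u" "\<forall>i<length ds. ev (u i) = 0"
    unfolding S_def by blast
  then show "\<forall>i<length ds. ev (v i) = 0" using frame_comb_inj[OF frame u(1)] by simp
next
  assume v: "\<forall>i<length ds. ev (v i) = 0"
  have "scale (v i) (w i) \<in> K" if i: "i < length ds" for i
  proof -
    obtain k where "v i = (\<Sum>g\<in>G. g * k g)" using ev_eq_0 v i by blast
    then have "scale (v i) (w i) = (\<Sum>g\<in>G. scale g (scale (k g) (w i)))"
      by (simp add: scale_sum_left)
    also have "\<dots> \<in> K"
      unfolding origin_submodule_def by (intro span_sum span_base) blast
    finally show ?thesis .
  qed
  then show "comb v \<in> K"
    unfolding frame_comb_def by (intro subspace_sum[OF subspace_K]) auto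
qed

lemma comb_coset_eq_iff:
  "comb u +o K = comb v +o K \<longleftrightarrow> (\<forall>i<length ds. ev (u i) = ev (v i))"
  by (simp add: coset_eq_iff[OF subspace_K] comb_in_K_iff ev_diff flip: frame_comb_diff)

lemma fibre_map_scale: "fibre_map scale G (scale r) (comb v +o K) = comb (\<lambda>i. r * v i) +o K"
  unfolding fibre_map_def
  by (subst coset_image[OF subspace_K])
    (auto simp: scale_right_distrib frame_comb_scale intro: subspace_scale[OF subspace_K])

text \<open>\<open>D j\<close> preserves \<open>K\<close> because, by \<open>ev_E\<close>, it
  multiplies the value of each coordinate at the origin by a constant.\<close>

lemma fibre_map_D: "fibre_map scale G (D j) (comb v +o K) = comb (\<lambda>i. E (ds ! i) j (v i)) +o K"
  unfolding fibre_map_def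
proof (subst coset_image[OF subspace_K])
  fix k assume k: "k \<in> K"
  obtain u where u: "k = comb u" by (rule obtain_coordinates)
  then show "D j k \<in> K" using k by (simp add: D_comb comb_in_K_iff ev_E)
qed (simp_all add: D_add D_comb)

lemma diagonal_monodromy: "diagonal_monodromy p m c G ds scale D"
proof -
  interpret residue: char_prime_level p m "TYPE('a)" by unfold_locales (rule CHAR_residue)
  \<comment> \<open>Coordinates are lifted by the section \<open>c\<close>; the coset depends only
    on their values under \<open>ev\<close>.\<close>
  define \<tau> where "\<tau> v = comb (\<lambda>i. c (v i)) +o K" for v
  have "trivialization (length ds) c scale G \<tau>"
    unfolding trivialization_def linear_iso_def bij_betw_def
  proof (intro conjI ballI allI)
    show "inj_on \<tau> (dsum_carrier (length ds))"
    proof (intro inj_onI ext)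
      fix u v i assume uv: "u \<in> dsum_carrier (length ds)" "v \<in> dsum_carrier (length ds)" "\<tau> u = \<tau> v"
      show "u i = v i"
      proof (cases "i < length ds")
        case True
        then show ?thesis using uv(3) by (simp add: \<tau>_def comb_coset_eq_iff ev_c)
      next
        case False
        then show ?thesis using uv(1,2) by (simp add: dsum_carrier_def)
      qed
    qed
    have "\<tau> v \<in> fibre scale G" for v by (simp add: \<tau>_def fibre_def)
    moreover have "x +o K \<in> \<tau> ` dsum_carrier (length ds)" for x
    proof -
      obtain v where "x = comb v" by (rule obtain_coordinates)
      then have "x +o K = \<tau> (\<lambda>i. if i < length ds then ev (v i) else 0)"
        by (simp add: \<tau>_def comb_coset_eq_iff ev_c)
      then show ?thesis by (auto simp: dsum_carrier_def)
    qed
    ultimately show "\<tau> ` dsum_carrier (length ds) = fibre scale G" by (auto simp: fibre_def)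
    show "\<tau> (u + v) = \<tau> u + \<tau> v" for u v
      unfolding \<tau>_def coset_add[OF subspace_K] frame_comb_add[symmetric] comb_coset_eq_iff
      by (simp add: ev_c ev_add)
    show "\<tau> (dsum_scale r v) = fibre_scale c scale G r (\<tau> v)" for r v
      unfolding \<tau>_def fibre_scale_def fibre_map_scale comb_coset_eq_iff
      by (simp add: ev_c ev_mult dsum_scale_def)
  qed
  moreover have "monodromy p scale D G a (\<tau> v) =
      \<tau> (\<lambda>i. if i < length ds then of_int (digit p a (neg_mod p m (ds ! i))) * v i else 0)"
    if "a \<le> m" for a v
  proof -
    have "(power_op_coeff p m (p ^ a) (- (ds ! i)) :: 'a) = of_int (digit p a (neg_mod p m (ds ! i)))"
      if "i < length ds" for i
      using residues that \<open>a \<le> m\<close> by (intro residue.power_op_coeff_digit) auto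
    then show ?thesis
      unfolding \<tau>_def monodromy_def fibre_map_D comb_coset_eq_iff by (simp add: ev_c ev_E)
  qed
  ultimately show ?thesis unfolding diagonal_monodromy_def by blast
qed

end

section \<open>Existence of the decomposition\<close>

context log_ring
begin

lemma decomposition:
  fixes scale :: "'o \<Rightarrow> 'f::ab_group_add \<Rightarrow> 'f"
  assumes local: "\<And>x y :: 'a. x + y dvd 1 \<Longrightarrow> x dvd 1 \<or> y dvd 1"
    and "diff_op_module p m (E 0) scale D" "free_of_rank n scale" "flat p m D"
  shows "\<exists>ds. length ds = n \<and> set ds \<subseteq> residues_mod p m \<and>
    iso_from_dsum E ds scale D \<and> diagonal_monodromy p m c G ds scale D"
proof -
  interpret M: diff_op_module p m "E 0" scale D by fact
  interpret F: flat_diff_op_module p m "E 0" scale D by unfold_locales fact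
  \<comment> \<open>Locality passes from the base ring to \<open>'o\<close>: \<open>ev\<close>
    preserves units and detects them.\<close>
  have "x dvd 1 \<or> y dvd 1" if unit: "x + y dvd 1" for x y :: 'o
  proof -
    obtain u where "1 = (x + y) * u" using unit by (rule dvdE)
    then have "ev x + ev y dvd 1" by (metis dvd_triv_left ev_1 ev_add ev_mult)
    then show ?thesis using local ev_unit by blast
  qed
  then obtain w e where frame: "F.is_frame n w"
    and e: "\<And>i. i < n \<Longrightarrow> e i < N \<and> F.homogeneous (e i) (w i)"
    using F.homogeneous_frame[OF _ assms(3)] by blast
  \<comment> \<open>Exponents are negated degrees; \<open>neg_mod\<close> is an involution on
    \<open>{0..<int N}\<close>, so negating again recovers the eigenvalues of degree
    \<open>e i\<close>.\<close>
  define ds where "ds = map (\<lambda>i. neg_mod p m (int (e i))) [0..<n]"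
  have len: "length ds = n" by (simp add: ds_def)
  have res: "neg_mod p m x \<in> residues_mod p m" for x
    using neg_mod_less[of x] by (simp add: residues_mod_def N_def)
  have "neg_mod p m (neg_mod p m (int (e i))) = int (e i)" if "i < n" for i
  proof -
    have "neg_mod p m (neg_mod p m (int (e i))) = (- ((- int (e i)) mod int N)) mod int N"
      by (simp add: neg_mod_def N_def)
    also have "\<dots> = int (e i) mod int N" by (simp add: mod_minus_eq)
    finally show ?thesis using e[OF that] by simp
  qed
  then have coeff: "(power_op_coeff p m j (- (ds ! i)) :: 'o) = power_op_coeff p m j (int (e i))"
    if "i < n" for i j
    using that res by (simp add: ds_def power_op_coeff_neg_mod)
  interpret log_frame p m E ev c G scale D w ds
  proof unfold_locales
    show "F.is_frame (length ds) w" using frame len by simp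
    show "set ds \<subseteq> residues_mod p m" using res by (auto simp: ds_def)
    show "D j (w i) = scale (power_op_coeff p m j (- (ds ! i))) (w i)" if "i < length ds" for i j
      using e[of i] that len by (simp add: coeff F.homogeneous_def)
  qed
  show ?thesis using len residues iso_from_dsum diagonal_monodromy by blast
qed

end

section \<open>The two local models\<close>

lemma fps_unit_if_nth_0_unit:
  fixes f :: "'a::comm_ring_1 fps"
  assumes "fps_nth f 0 dvd 1"
  shows "f dvd 1"
proof -
  obtain u where "fps_nth f 0 * u = 1" using assms by (metis dvdE)
  then show ?thesis by (metis dvd_triv_left fps_right_inverse)
qed

lemma fps_eq_X_mult:
  fixes f :: "'a::comm_ring_1 fps"
  assumes "fps_nth f 0 = 0"
  shows "f = fps_X * Abs_fps (\<lambda>k. fps_nth f (Suc k))"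
proof (rule fps_ext)
  fix k show "fps_nth f k = fps_nth (fps_X * Abs_fps (\<lambda>k. fps_nth f (Suc k))) k"
    using assms by (cases k) auto
qed

lemma zp_reduce_fps: "(zp_reduce p x :: 'a::comm_ring_1 fps) = fps_const (zp_reduce p x)"
  by (cases "quotient_of x") (simp add: zp_reduce_def fps_of_int del: of_int_mult)

lemma CHAR_fps: "CHAR('a::comm_ring_1 fps) = CHAR('a)"
proof (rule CHAR_eqI)
  show "(of_nat CHAR('a) :: 'a fps) = 0" by (simp flip: fps_of_nat)
next
  fix n assume "(of_nat n :: 'a fps) = 0"
  then have "(of_nat n :: 'a) = 0" by (simp flip: fps_of_nat)
  then show "CHAR('a) dvd n" by (simp add: of_nat_eq_0_iff_char_dvd)
qed

lemma smooth_log_ring: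
  assumes "Factorial_Ring.prime p" "CHAR('a::comm_ring_1) = p"
  shows "log_ring p m (smooth_op p m :: int \<Rightarrow> nat \<Rightarrow> 'a fps \<Rightarrow> 'a fps) (\<lambda>f. fps_nth f 0) fps_const {fps_X}"
proof
  interpret char_prime_level p m "TYPE('a)" using assms by unfold_locales
  show "Factorial_Ring.prime p" by fact
  show "CHAR('a fps) = p" "CHAR('a) = p" using assms(2) by (simp_all add: CHAR_fps)
  show "fps_nth x 0 dvd 1 \<Longrightarrow> x dvd 1" for x :: "'a fps" by (rule fps_unit_if_nth_0_unit)
  show "\<exists>k. x = (\<Sum>g\<in>{fps_X}. g * k g)" if "fps_nth x 0 = 0" for x :: "'a fps"
    using fps_eq_X_mult[OF that] by (intro exI[of _ "\<lambda>_. Abs_fps (\<lambda>k. fps_nth x (Suc k))"]) simp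
  show "smooth_op p m d j (x + y) = smooth_op p m d j x + smooth_op p m d j y" for d j and x y :: "'a fps"
    by (rule fps_ext) (simp add: smooth_op_def distrib_left)
  show "smooth_op p m d j x = (\<Sum>i\<le>j. zp_reduce p (leibniz_coeff p m i (j - i)) * smooth_op p m 0 i x *
      power_op_coeff p m (j - i) (- d))" for d j and x :: "'a fps"
  proof (rule fps_ext)
    fix k
    \<comment> \<open>The k-th power of the variable has degree \<open>k\<close> and the twist adds
      \<open>- d\<close>, so each coefficient is a case of
      \<open>leibniz_Vandermonde\<close>.\<close>
    have "fps_nth (\<Sum>i\<le>j. zp_reduce p (leibniz_coeff p m i (j - i)) * smooth_op p m 0 i x *
        power_op_coeff p m (j - i) (- d)) k =
      (\<Sum>i\<le>j. zp_reduce p (leibniz_coeff p m i (j - i)) * power_op_coeff p m i (int k) *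
        power_op_coeff p m (j - i) (- d)) * fps_nth x k"
      by (simp add: fps_sum_nth zp_reduce_fps power_op_coeff_def smooth_op_def sum_distrib_left sum_distrib_right mult_ac)
    then show "fps_nth (smooth_op p m d j x) k = fps_nth (\<Sum>i\<le>j. zp_reduce p (leibniz_coeff p m i (j - i)) *
        smooth_op p m 0 i x * power_op_coeff p m (j - i) (- d)) k"
      by (simp add: leibniz_Vandermonde smooth_op_def)
  qed
qed (auto simp: smooth_op_def)

text \<open>A power series whose monomials all involve both variables is divisible by
  \<open>t1t2\<close>, so the ring embeds in the product of its branches. Identities can thus be
  checked on each branch.\<close>

lemma node_eqI:
  assumes "branch1 f = branch1 g" "branch2 f = branch2 g"
  shows "f = g"
  using assms by transfer (auto simp: node_rel_def t1t2_dvd_iff fps_eq_iff)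

lemma branch1_add: "branch1 (f + g) = branch1 f + branch1 g"
  by transfer simp

lemma branch1_0: "branch1 0 = 0" and branch2_0: "branch2 0 = 0"
  by (transfer, auto intro: fps_ext)+

lemma branch1_1: "branch1 1 = 1" and branch2_1: "branch2 1 = 1"
  by (transfer, auto intro!: fps_ext)+

lemma branch1_mult: "branch1 (f * g) = branch1 f * branch1 g"
  by transfer (simp add: fps_mult_nth)

lemma branch2_mult: "branch2 (f * g) = branch2 f * branch2 g"
  by transfer (auto simp: fps_mult_nth fps_sum_nth intro!: fps_ext)

lemma branch1_sum: "branch1 (sum f A) = (\<Sum>x\<in>A. branch1 (f x))"
  by (induction A rule: infinite_finite_induct) (auto simp: branch1_0 branch1_add)

lemma branch1_of_nat: "branch1 (of_nat n) = of_nat n" and branch2_of_nat: "branch2 (of_nat n) = of_nat n"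
  by (induction n) (auto simp: branch1_0 branch1_1 branch1_add branch2_0 branch2_1 branch2_add)

lemma branch_of_int:
  shows "branch1 (of_int z :: 'a::comm_ring_1 node) = of_int z"
    and "branch2 (of_int z :: 'a node) = of_int z"
proof -
  have "branch1 (- f) = - branch1 f" "branch2 (- f) = - branch2 f" for f :: "'a node"
    by (transfer, auto intro: fps_ext)+
  then show "branch1 (of_int z :: 'a node) = of_int z" "branch2 (of_int z :: 'a node) = of_int z"
    by (cases z; simp only: of_int_of_nat_eq branch1_of_nat branch2_of_nat of_int_minus)+
qed

lemma branch_zp_reduce: "branch1 (zp_reduce p x) = zp_reduce p x" "branch2 (zp_reduce p x) = zp_reduce p x"
  by (cases "quotient_of x"; simp add: zp_reduce_def branch_of_int del: of_int_mult)+

lemma CHAR_node: "CHAR('a::comm_ring_1 node) = CHAR('a)"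
proof (rule CHAR_eqI)
  have "(of_nat CHAR('a) :: 'a fps) = 0" by (simp flip: fps_of_nat)
  then show "(of_nat CHAR('a) :: 'a node) = 0"
    by (intro node_eqI) (simp_all add: branch1_of_nat branch2_of_nat branch1_0 branch2_0)
next
  fix n assume "(of_nat n :: 'a node) = 0"
  then have "branch1 (of_nat n :: 'a node) = branch1 0" by simp
  then have "(of_nat n :: 'a fps) = 0" by (simp only: branch1_of_nat branch1_0)
  then show "CHAR('a) dvd n" using CHAR_fps by (metis of_nat_eq_0_iff_char_dvd)
qed

lemma branch1_node_op_nth:
  "fps_nth (branch1 (node_op p m d j f)) k = power_op_coeff p m j (int k - d) * fps_nth (branch1 f) k"
  by transfer simp

text \<open>A representative is a power series in t2 over power series in t1, so the criterion on
  constant terms is applied twice.\<close>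

lemma node_unit:
  assumes "fps_nth (branch1 f) 0 dvd 1"
  shows "f dvd 1"
proof -
  have "\<exists>g. 1 = f * g"
    using assms
  proof transfer
    fix f :: "'a fps fps"
    assume "fps_nth (fps_nth f 0) 0 dvd 1"
    then have "f dvd 1" by (intro fps_unit_if_nth_0_unit)
    then obtain g where "1 = f * g" by (rule dvdE)
    then show "\<exists>g. node_rel 1 (f * g)" by (intro exI[of _ g]) (simp add: node_rel_def)
  qed
  then show ?thesis by (auto intro: dvdI)
qed

text \<open>The part free of t2 has constant term 0 and is a multiple of t1; the rest is a multiple
  of t2.\<close>

lemma node_eq_sum_t1_t2:
  assumes "fps_nth (branch1 f) 0 = 0"
  shows "\<exists>g h. f = node_t1 * g + node_t2 * h"
  using assms
proof transfer
  fix f :: "'a fps fps"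
  assume "fps_nth (fps_nth f 0) 0 = 0"
  then have 0: "fps_nth f 0 = fps_X * Abs_fps (\<lambda>k. fps_nth (fps_nth f 0) (Suc k))"
    by (rule fps_eq_X_mult)
  have "f - fps_const (fps_nth f 0) = fps_X * Abs_fps (\<lambda>k. fps_nth (f - fps_const (fps_nth f 0)) (Suc k))"
    by (rule fps_eq_X_mult) simp
  then have "f = fps_const (fps_nth f 0) + fps_X * Abs_fps (\<lambda>k. fps_nth (f - fps_const (fps_nth f 0)) (Suc k))"
    by (simp only: diff_eq_eq add.commute)
  then have "f = fps_const fps_X * fps_const (Abs_fps (\<lambda>k. fps_nth (fps_nth f 0) (Suc k))) +
      fps_X * Abs_fps (\<lambda>k. fps_nth (f - fps_const (fps_nth f 0)) (Suc k))"
    using 0 by (metis fps_const_mult)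
  then show "\<exists>g h. node_rel f (fps_const fps_X * g + fps_X * h)"
    by (metis diff_self dvd_0_right node_rel_def)
qed

lemma node_log_ring:
  assumes "Factorial_Ring.prime p" "CHAR('a::comm_ring_1) = p"
  shows "log_ring p m (node_op p m :: int \<Rightarrow> nat \<Rightarrow> 'a node \<Rightarrow> 'a node)
    (\<lambda>f. fps_nth (branch1 f) 0) node_const {node_t1, node_t2}"
proof
  interpret char_prime_level p m "TYPE('a)" using assms by unfold_locales
  have t1: "branch1 (node_t1 :: 'a node) = fps_X" by transfer simp
  have t2: "branch1 (node_t2 :: 'a node) = 0" by transfer simp
  \<comment> \<open>The sum over the set of generators has two terms only because they
    differ.\<close>
  have t12: "(node_t1 :: 'a node) \<noteq> node_t2"
  proof
    assume "(node_t1 :: 'a node) = node_t2"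
    then have "(fps_X :: 'a fps) = 0" using t1 t2 by metis
    then show False by simp
  qed
  show "Factorial_Ring.prime p" by fact
  show "CHAR('a node) = p" "CHAR('a) = p" using assms(2) by (simp_all add: CHAR_node)
  show "fps_nth (branch1 (node_const r)) 0 = r" for r :: 'a by transfer simp
  show "fps_nth (branch1 x) 0 dvd 1 \<Longrightarrow> x dvd 1" for x :: "'a node" by (rule node_unit)
  show "fps_nth (branch1 g) 0 = 0" if "g \<in> {node_t1, node_t2}" for g :: "'a node"
    using that t1 t2 by auto
  show "\<exists>k. x = (\<Sum>g\<in>{node_t1, node_t2}. g * k g)" if x: "fps_nth (branch1 x) 0 = 0" for x :: "'a node"
  proof -
    obtain g h where "x = node_t1 * g + node_t2 * h" using node_eq_sum_t1_t2[OF x] by blast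
    then show ?thesis
      using t12 by (intro exI[of _ "\<lambda>t. if t = node_t1 then g else h"]) auto
  qed
  show "node_op p m d j (x + y) = node_op p m d j x + node_op p m d j y" for d j and x y :: "'a node"
    by (intro node_eqI fps_ext)
      (simp_all add: branch1_add branch2_add branch1_node_op_nth branch2_node_op_nth distrib_left)
  show "node_op p m d j x = (\<Sum>i\<le>j. zp_reduce p (leibniz_coeff p m i (j - i)) * node_op p m 0 i x *
      power_op_coeff p m (j - i) (- d))" for d j and x :: "'a node"
  proof (intro node_eqI fps_ext)
    let ?S = "\<Sum>i\<le>j. zp_reduce p (leibniz_coeff p m i (j - i)) * node_op p m 0 i x * power_op_coeff p m (j - i) (- d)"
    fix k
    have "fps_nth (branch1 ?S) k =
      (\<Sum>i\<le>j. zp_reduce p (leibniz_coeff p m i (j - i)) * power_op_coeff p m i (int k) *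
        power_op_coeff p m (j - i) (- d)) * fps_nth (branch1 x) k"
      \<comment> \<open>Only coefficients of order \<open>j - i\<close> are unfolded: as elements of
        the ring of the node they must be carried to the branch through
        \<open>zp_reduce\<close>.\<close>
      by (simp add: branch1_sum branch1_mult branch_zp_reduce fps_sum_nth zp_reduce_fps
          power_op_coeff_def[of _ _ "_ - _"] branch1_node_op_nth sum_distrib_left sum_distrib_right mult_ac)
    then show "fps_nth (branch1 (node_op p m d j x)) k = fps_nth (branch1 ?S) k"
      by (simp add: leibniz_Vandermonde branch1_node_op_nth)
    have "fps_nth (branch2 ?S) k =
      (\<Sum>i\<le>j. zp_reduce p (leibniz_coeff p m i (j - i)) * power_op_coeff p m i (- int k) *
        power_op_coeff p m (j - i) (- d)) * fps_nth (branch2 x) k"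
      by (simp add: branch2_sum branch2_mult branch_zp_reduce fps_sum_nth zp_reduce_fps
          power_op_coeff_def[of _ _ "_ - _"] branch2_node_op_nth sum_distrib_left sum_distrib_right mult_ac)
    then show "fps_nth (branch2 (node_op p m d j x)) k = fps_nth (branch2 ?S) k"
      by (simp add: leibniz_Vandermonde branch2_node_op_nth)
  qed
qed (auto simp: branch1_add branch1_mult branch1_1 branch1_node_op_nth)

theorem mainTheorem8:
  fixes p m :: nat and MM :: "'a::comm_ring_1 set"
  assumes "Factorial_Ring.prime p" and "CHAR('a) = p"
    and "maximalideal MM (ring_of_type_algebra :: 'a ring)"
    and "\<And>I. maximalideal I (ring_of_type_algebra :: 'a ring) \<Longrightarrow> I = MM"
    and "algebraically_closed ((ring_of_type_algebra :: 'a ring) Quot MM)"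
  shows
    "(\<forall>n (scale :: 'a fps \<Rightarrow> 'f::ab_group_add \<Rightarrow> 'f) D.
       n > 0 \<and> diff_op_module p m (smooth_op p m 0) scale D \<and>
       free_of_rank n scale \<and> flat p m D \<longrightarrow>
       (\<exists>ds. length ds = n \<and> set ds \<subseteq> residues_mod p m \<and>
          iso_from_dsum (smooth_op p m) ds scale D \<and>
          diagonal_monodromy p m fps_const {fps_X} ds scale D) \<and>
       (\<forall>(scale' :: 'a fps \<Rightarrow> 'f' \<Rightarrow> 'f'::ab_group_add) D' ds ds'.
          isomorphic scale D scale' D' \<and>
          length ds = n \<and> set ds \<subseteq> residues_mod p m \<and>
          iso_from_dsum (smooth_op p m) ds scale D \<and>
          length ds' = n \<and> set ds' \<subseteq> residues_mod p m \<and>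
          iso_from_dsum (smooth_op p m) ds' scale' D' \<longrightarrow>
          mset ds = mset ds')) \<and>
     (\<forall>n (scale :: 'a node \<Rightarrow> 'g::ab_group_add \<Rightarrow> 'g) D.
       n > 0 \<and> diff_op_module p m (node_op p m 0) scale D \<and>
       free_of_rank n scale \<and> flat p m D \<longrightarrow>
       (\<exists>ds. length ds = n \<and> set ds \<subseteq> residues_mod p m \<and>
          iso_from_dsum (node_op p m) ds scale D \<and>
          diagonal_monodromy p m node_const {node_t1, node_t2} ds scale D) \<and>
       (\<forall>(scale' :: 'a node \<Rightarrow> 'g' \<Rightarrow> 'g'::ab_group_add) D' ds ds'.
          isomorphic scale D scale' D' \<and>
          length ds = n \<and> set ds \<subseteq> residues_mod p m \<and>
          iso_from_dsum (node_op p m) ds scale D \<and>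
          length ds' = n \<and> set ds' \<subseteq> residues_mod p m \<and>
          iso_from_dsum (node_op p m) ds' scale' D' \<longrightarrow>
          mset ds = mset ds'))"
proof (intro conjI)
  interpret smooth: log_ring p m "smooth_op p m :: int \<Rightarrow> nat \<Rightarrow> 'a fps \<Rightarrow> 'a fps"
    "\<lambda>f. fps_nth f 0" fps_const "{fps_X}"
    by (rule smooth_log_ring) fact+
  interpret node: log_ring p m "node_op p m :: int \<Rightarrow> nat \<Rightarrow> 'a node \<Rightarrow> 'a node"
    "\<lambda>f. fps_nth (branch1 f) 0" node_const "{node_t1, node_t2}"
    by (rule node_log_ring) fact+
  \<comment> \<open>The form in which uniqueness of the maximal ideal enters both
    decompositions.\<close>
  have local: "x dvd 1 \<or> y dvd 1" if "x + y dvd 1" for x y :: 'a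
    using unit_sum_if_unique_maximalideal[OF assms(4) that] .
  show "\<forall>n (scale :: 'a fps \<Rightarrow> 'f \<Rightarrow> 'f) D.
       n > 0 \<and> diff_op_module p m (smooth_op p m 0) scale D \<and>
       free_of_rank n scale \<and> flat p m D \<longrightarrow>
       (\<exists>ds. length ds = n \<and> set ds \<subseteq> residues_mod p m \<and>
          iso_from_dsum (smooth_op p m) ds scale D \<and>
          diagonal_monodromy p m fps_const {fps_X} ds scale D) \<and>
       (\<forall>(scale' :: 'a fps \<Rightarrow> 'f' \<Rightarrow> 'f') D' ds ds'.
          isomorphic scale D scale' D' \<and>
          length ds = n \<and> set ds \<subseteq> residues_mod p m \<and>
          iso_from_dsum (smooth_op p m) ds scale D \<and>
          length ds' = n \<and> set ds' \<subseteq> residues_mod p m \<and>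
          iso_from_dsum (smooth_op p m) ds' scale' D' \<longrightarrow>
          mset ds = mset ds')"
    by (intro allI impI conjI) (metis smooth.decomposition[OF local], metis smooth.exponents_unique)
  show "\<forall>n (scale :: 'a node \<Rightarrow> 'g \<Rightarrow> 'g) D.
       n > 0 \<and> diff_op_module p m (node_op p m 0) scale D \<and>
       free_of_rank n scale \<and> flat p m D \<longrightarrow>
       (\<exists>ds. length ds = n \<and> set ds \<subseteq> residues_mod p m \<and>
          iso_from_dsum (node_op p m) ds scale D \<and>
          diagonal_monodromy p m node_const {node_t1, node_t2} ds scale D) \<and>
       (\<forall>(scale' :: 'a node \<Rightarrow> 'g' \<Rightarrow> 'g') D' ds ds'.
          isomorphic scale D scale' D' \<and>
          length ds = n \<and> set ds \<subseteq> residues_mod p m \<and>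
          iso_from_dsum (node_op p m) ds scale D \<and>
          length ds' = n \<and> set ds' \<subseteq> residues_mod p m \<and>
          iso_from_dsum (node_op p m) ds' scale' D' \<longrightarrow>
          mset ds = mset ds')"
    by (intro allI impI conjI) (metis node.decomposition[OF local], metis node.exponents_unique)
qed

end
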